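(* Consider the iterates $(x^k)_{k\ge 0}$ and $(h_m^k)_{k\ge 0}$, $m\in[M]$, generated by the algorithm DIANA (defined in the context) with $\lambda=\frac{1}{1+\omega_{\mathcal C}}$ and $\rho=\frac1{1+\omega_{\mathcal R}}$. Choose a real $b>1$ and set $a=\max\big(1-(1+b)\zeta,0\big)$. Suppose that $$0<\gamma\le\frac1L\,\frac1{a+(1+b)^2\omega_{\mathrm{av}}}.$$ For every $k\ge 0$ define $$\Psi^k=\|x^k-x^\star\|^2+(b^2+b)\gamma^2\omega_{\mathrm{av}}\frac{1+\omega_{\mathcal C}}{1+\omega_{\mathcal R}}\frac1M\sum_{m=1}^M\|h_m^k-h_m^\star\|^2 .$$ Then, for every $k\ge0$, $\mathbb E[\Psi^k]\le c^k\Psi^0$, where $$c=1-\min\left\{\frac{\gamma\mu}{1+\omega_{\mathcal R}},\ \frac{1-b^{-2}}{1+\omega_{\mathcal C}}\right\}<1 .$$ Consequently, if $b$ is fixed and $\gamma=\Theta\big(\frac1L\frac1{a+(1+b)^2\omega_{\mathrm{av}}}\big)$, the number of iterations needed to achieve $\epsilon$-accuracy is $$\mathcal O\Big(\big(\kappa(1+\omega_{\mathrm{av}})(1+\omega_{\mathcal R})+\omega_{\mathcal C}\big)\log(1/\epsilon)\Big);$$ that is, for every $b>1$ and $\theta\in(0,1]$ there is a constant $C$ depending only on $b$ and $\theta$ such that, whenever $\frac{\theta}{L}\frac1{a+(1+b)^2\omega_{\mathrm{av}}}\le\gamma\le\frac1L\frac1{a+(1+b)^2\omega_{\mathrm{av}}}$,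 for every $\epsilon\in(0,\frac12]$ one has $\mathbb E[\Psi^k]\le\epsilon\Psi^0$ for all integers $k\ge C\big(\kappa(1+\omega_{\mathrm{av}})(1+\omega_{\mathcal R})+\omega_{\mathcal C}\big)\log(1/\epsilon)$.
   Context: Problem. Let $d\ge1$, $M\ge1$, $[M]=\{1,\dots,M\}$. Let $F_1,\dots,F_M:\mathbb R^d\to\mathbb R$ be convex, differentiable and $L$-smooth for some $L>0$ (i.e. $\nabla F_m$ is $L$-Lipschitz), let $F=\frac1M\sum_{m=1}^M F_m$ be $\mu$-strongly convex for some $\mu>0$ (i.e. $F-\frac\mu2\|\cdot\|^2$ is convex), and let $R:\mathbb R^d\to\mathbb R\cup\{+\infty\}$ be proper, closed, convex. Let $x^\star$ be the unique minimizer of $R+F$, $h_m^\star=\nabla F_m(x^\star)$, and $\kappa=L/\mu$. For $\gamma>0$, $\mathrm{prox}_{\gamma R}(w)=\arg\min_{x}\big(\gamma R(x)+\frac12\|x-w\|^2\big)$. Norms are Euclidean. Stochastic operators. For every $k\ge0$ and $m\in[M]$, $\mathcal C_m^k,\mathcal R^k$ are random maps $\mathbb R^d\to\mathbb R^d$ such that for all $v\in\mathbb R^d$: $\mathbb E[\mathcal C_m^k(v)]=v$, $\mathbb E\|\mathcal C_m^k(v)-v\|^2\le\omega_{\mathcal C}\|v\|^2$; $\mathbb E[\mathcal R^k(v)]=v$, $\mathbb E\|\mathcal R^k(v)-v\|^2\le\omega_{\mathcal R}\|v\|^2$, for constants $\omega_{\mathcal C},\omega_{\mathcal R}\ge0$.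 Moreover there are constants $\omega_{\mathrm{av}}\ge0$ and $\zeta\in[0,\omega_{\mathrm{av}}]$, with $\omega_{\mathrm{av}}\le\omega_{\mathcal C}$, such that for every $k$ and all $v_1,\dots,v_M\in\mathbb R^d$, $$\mathbb E\Big\|\frac1M\sum_{m=1}^M(\mathcal C_m^k(v_m)-v_m)\Big\|^2\le\frac{\omega_{\mathrm{av}}}{M}\sum_{m=1}^M\|v_m\|^2-\zeta\Big\|\frac1M\sum_{m=1}^M v_m\Big\|^2 .$$ The collections $(\mathcal C_m^k)_{m\in[M]}$ for different $k$ are independent; for a fixed $k$ the operators $\mathcal C_m^k$, $m\in[M]$, may be arbitrarily dependent. The $\mathcal R^k$, $k\ge0$, are mutually independent and independent of all $\mathcal C_m^{k'}$. (The random maps are assumed measurable, so that the unbiasedness of $\mathcal C_m^k,\mathcal R^k$, their variance bounds with constants $\omega_{\mathcal C},\omega_{\mathcal R}$, and the bound with constants $\omega_{\mathrm{av}},\zeta$ on the second moment of $\frac1M\sum_{m=1}^M(\mathcal C_m^k(v_m)-v_m)$ also hold conditionally when the operators are applied to random vectors independent of them.) Algorithm DIANA. Input: $\gamma,\lambda,\rho>0$, deterministic $x^0\in\mathbb R^d$ and $h_1^0,\dots,h_M^0\in\mathbb R^d$; $h^0=\frac1M\sum_m h_m^0$. For $k=0,1,\dots$: for every $m\in[M]$, $d_m^{k+1}=\mathcal C_m^k(\nabla F_m(x^k)-h_m^k)$, $h_m^{k+1}=h_m^k+\lambda d_m^{k+1}$; then $d^{k+1}=\frac1M\sum_m d_m^{k+1}$,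 $h^{k+1}=h^k+\lambda d^{k+1}$, $\tilde x^{k+1}=\mathrm{prox}_{\gamma R}\big(x^k-\gamma(h^k+d^{k+1})\big)$, $x^{k+1}=x^k+\rho\,\mathcal R^k(\tilde x^{k+1}-x^k)$. *)

theory Defs
  imports "HOL-Probability.Probability"
begin

definition ereal_epigraph :: "('a \<Rightarrow> ereal) \<Rightarrow> ('a \<times> real) set" where
  "ereal_epigraph R = {(x, t). R x \<le> ereal t}"

definition proper_closed_convex :: "('a::real_normed_vector \<Rightarrow> ereal) \<Rightarrow> bool" where
  "proper_closed_convex R \<longleftrightarrow>
     (\<forall>x. R x \<noteq> -\<infinity>) \<and> (\<exists>x. R x \<noteq> \<infinity>) \<and>
     closed (ereal_epigraph R) \<and> convex (ereal_epigraph R)"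

definition prox :: "real \<Rightarrow> ('a::real_normed_vector \<Rightarrow> ereal) \<Rightarrow> 'a \<Rightarrow> 'a" where
  "prox \<gamma> R w = arg_min (\<lambda>x. ereal \<gamma> * R x + ereal ((norm (x - w))\<^sup>2 / 2)) (\<lambda>_. True)"

text \<open>The integrability requirements say that the moments exist and are finite; the
  Bochner integral of a non-integrable function is 0, so they cannot be left implicit.\<close>

definition unbiased_op ::
    "'w measure \<Rightarrow> real \<Rightarrow> ('w \<Rightarrow> 'a::euclidean_space \<Rightarrow> 'a) \<Rightarrow> bool" where
  "unbiased_op P \<omega> T \<longleftrightarrow>
     (\<forall>v. integrable P (\<lambda>s. T s v) \<and> (\<integral>s. T s v \<partial>P) = v \<and>
          integrable P (\<lambda>s. (norm (T s v - v))\<^sup>2) \<and>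
          (\<integral>s. (norm (T s v - v))\<^sup>2 \<partial>P) \<le> \<omega> * (norm v)\<^sup>2)"

text \<open>\<open>A k\<close> carries the randomness of the whole collection \<open>(C k m)\<close>, \<open>1 \<le> m \<le> M\<close>, whose
  members may thus be arbitrarily dependent, and \<open>B k\<close> carries the randomness of \<open>Q k\<close>.
  Each random map is jointly measurable with respect to its own sigma-algebra and the argument.
  Independence of the evaluations at fixed points, together with joint measurability for \<open>P\<close>
  alone, would be too weak: it does not control the maps at independent random arguments.\<close>

definition indep_random_maps ::
    "'w measure \<Rightarrow> nat \<Rightarrow> (nat \<Rightarrow> nat \<Rightarrow> 'w \<Rightarrow> 'a::euclidean_space \<Rightarrow> 'a) \<Rightarrow>
     (nat \<Rightarrow> 'w \<Rightarrow> 'a \<Rightarrow> 'a) \<Rightarrow> bool" where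
  "indep_random_maps P M C Q \<longleftrightarrow>
     (\<exists>A B :: nat \<Rightarrow> 'w measure.
        (\<forall>k. subalgebra P (A k) \<and> subalgebra P (B k)) \<and>
        prob_space.indep_sets P (case_sum (\<lambda>k. sets (A k)) (\<lambda>k. sets (B k))) UNIV \<and>
        (\<forall>k. \<forall>m\<in>{1..M}. (\<lambda>(s, v). C k m s v) \<in> borel_measurable (A k \<Otimes>\<^sub>M borel)) \<and>
        (\<forall>k. (\<lambda>(s, v). Q k s v) \<in> borel_measurable (B k \<Otimes>\<^sub>M borel)))"

text \<open>One realization of the algorithm, for realized operators \<open>C k m\<close> and \<open>Q k\<close> and gradients
  \<open>g m\<close>. The state is \<open>(x\<^sup>k, m \<mapsto> h\<^sub>m\<^sup>k, h\<^sup>k)\<close>.\<close>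

primrec diana ::
    "nat \<Rightarrow> (nat \<Rightarrow> 'a::euclidean_space \<Rightarrow> 'a) \<Rightarrow> ('a \<Rightarrow> ereal) \<Rightarrow> real \<Rightarrow> real \<Rightarrow> real \<Rightarrow>
     'a \<Rightarrow> (nat \<Rightarrow> 'a) \<Rightarrow> (nat \<Rightarrow> nat \<Rightarrow> 'a \<Rightarrow> 'a) \<Rightarrow> (nat \<Rightarrow> 'a \<Rightarrow> 'a) \<Rightarrow>
     nat \<Rightarrow> 'a \<times> (nat \<Rightarrow> 'a) \<times> 'a" where
  "diana M g R \<gamma> lam \<rho> x0 h0 C Q 0 = (x0, h0, (1 / real M) *\<^sub>R (\<Sum>m=1..M. h0 m))"
| "diana M g R \<gamma> lam \<rho> x0 h0 C Q (Suc k) =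
     (let (x, h, hbar) = diana M g R \<gamma> lam \<rho> x0 h0 C Q k;
          d = (\<lambda>m. C k m (g m x - h m));
          dbar = (1 / real M) *\<^sub>R (\<Sum>m=1..M. d m);
          xt = prox \<gamma> R (x - \<gamma> *\<^sub>R (hbar + dbar))
      in (x + \<rho> *\<^sub>R Q k (xt - x), \<lambda>m. h m + lam *\<^sub>R d m, hbar + lam *\<^sub>R dbar))"

definition lyapunov ::
    "nat \<Rightarrow> (nat \<Rightarrow> 'a::euclidean_space \<Rightarrow> 'a) \<Rightarrow> 'a \<Rightarrow> real \<Rightarrow> real \<Rightarrow> real \<Rightarrow> real \<Rightarrow> real \<Rightarrow>
     'a \<times> (nat \<Rightarrow> 'a) \<times> 'a \<Rightarrow> real" where
  "lyapunov M g xs b \<gamma> \<omega>av \<omega>C \<omega>R = (\<lambda>(x, h, hbar).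
     (norm (x - xs))\<^sup>2 +
     (b\<^sup>2 + b) * \<gamma>\<^sup>2 * \<omega>av * ((1 + \<omega>C) / (1 + \<omega>R)) *
       ((1 / real M) * (\<Sum>m=1..M. (norm (h m - g m xs))\<^sup>2)))"

text \<open>The constant hidden in the iteration complexity. It has to depend on \<open>b\<close> and \<open>\<theta>\<close> only,
  in particular not on the dimension, which is encoded in a type, nor on the type of the
  sample space. An existential quantifier inside a theorem that is polymorphic in these types
  would allow such a dependence, so a witness is fixed here once and for all. Its two parts
  bound \<open>(a + (1 + b)\<^sup>2 \<omega>\<^sub>a\<^sub>v) / (\<theta> (1 + \<omega>\<^sub>a\<^sub>v))\<close> and \<open>1 / (1 - b\<^sup>-\<^sup>2)\<close>.\<close>

definition complexity_const :: "real \<Rightarrow> real \<Rightarrow> real" where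
  "complexity_const b \<theta> = max ((1 + b)\<^sup>2 / \<theta>) (1 / (1 - 1 / b\<^sup>2))"

end

theory Submission
  imports Defs
begin

text \<open>Since \<open>x\<^sup>\<star> = prox(x\<^sup>\<star> - \<gamma> h\<^sup>\<star>)\<close> and the proximal map is nonexpansive, the expected squared
  distance of the proximal point to \<open>x\<^sup>\<star>\<close> is at most that of an exact gradient step plus
  \<open>\<gamma>\<^sup>2\<close> times the variance of the averaged compressed differences. Young's inequality with
  parameter \<open>b\<close> splits this variance into a part controlled by \<open>|\<nabla>F\<^sub>m(x) - h\<^sub>m\<^sup>\<star>|\<^sup>2\<close> and a part
  controlled by \<open>|h\<^sub>m - h\<^sub>m\<^sup>\<star>|\<^sup>2\<close>. Cocoercivity of the gradients absorbs the former for small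
  \<open>\<gamma>\<close>, and the contraction of the memory terms \<open>h\<^sub>m\<close>, weighted in the Lyapunov function,
  absorbs the latter.\<close>

subsection \<open>Convex functions and quadratic forms\<close>

text \<open>The maps are evaluated at random arguments, so their moments at fixed vectors do not
  apply directly. Within one iteration the proximal point depends on the fresh compressors but not
  on \<open>Q k\<close>. Hence \<open>Q k\<close> is integrated out first, with the past and the
  compressors frozen, and then the compressors, with the past frozen; each time the inner integral
  is a moment estimate at fixed vectors. Nonnegative extended integrals are used throughout, so that
  integrability of the Lyapunov function follows from the descent instead of preceding it.

  The parameter \<open>b\<close> trades step size against rate. The weight of the memory term is
  such that the fraction \<open>1 / b\<^sup>2\<close> of its contraction \<open>lam\<close> pays for
  the variance that Young's inequality assigns to the memory; the remaining fraction
  \<open>1 - 1 / b\<^sup>2\<close> is the one in the rate. A larger \<open>b\<close> improves it, at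
  the price of the factor \<open>(1 + b)\<^sup>2\<close> in front of \<open>\<omega>av\<close> in
  the step size bound.\<close>

lemma gderiv_along_line:
  assumes "GDERIV f (x + t *\<^sub>R d) :> g"
  shows "((\<lambda>t. f (x + t *\<^sub>R d)) has_real_derivative (g \<bullet> d)) (at t)"
proof -
  have f: "(f has_derivative (\<lambda>h. g \<bullet> h)) (at (x + t *\<^sub>R d))"
    using assms by (simp add: gderiv_def inner_commute)
  have l: "((\<lambda>t. x + t *\<^sub>R d) has_derivative (\<lambda>h. h *\<^sub>R d)) (at t)"
    by (auto intro!: derivative_eq_intros)
  have "((\<lambda>t. f (x + t *\<^sub>R d)) has_derivative (\<lambda>h. g \<bullet> (h *\<^sub>R d))) (at t)"
    using has_derivative_compose[OF l f] .
  then show ?thesis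
    by (simp add: has_field_derivative_def mult.commute[of _ "g \<bullet> d"])
qed

text \<open>Restriction to the line through \<open>x\<close> and \<open>y\<close> reduces this to
  the tangent inequality for convex functions of one real variable.\<close>

lemma convex_on_above_gradient:
  fixes f :: "'a::real_inner \<Rightarrow> real"
  assumes "convex_on UNIV f" "GDERIV f x :> g"
  shows "f x + g \<bullet> (y - x) \<le> f y"
proof -
  let ?\<phi> = "\<lambda>t. f (x + t *\<^sub>R (y - x))"
  have "convex_on UNIV ?\<phi>"
  proof (rule convex_onI)
    fix t u v :: real assume t: "0 < t" "t < 1"
    have "x + ((1 - t) *\<^sub>R u + t *\<^sub>R v) *\<^sub>R (y - x)
        = (1 - t) *\<^sub>R (x + u *\<^sub>R (y - x)) + t *\<^sub>R (x + v *\<^sub>R (y - x))"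
      by (simp add: algebra_simps)
    then show "?\<phi> ((1 - t) *\<^sub>R u + t *\<^sub>R v) \<le> (1 - t) * ?\<phi> u + t * ?\<phi> v"
      using convex_onD[OF assms(1), of t "x + u *\<^sub>R (y - x)" "x + v *\<^sub>R (y - x)"] t by simp
  qed simp
  moreover have "(?\<phi> has_real_derivative (g \<bullet> (y - x))) (at 0)"
    by (rule gderiv_along_line) (simp add: assms)
  ultimately have "?\<phi> 1 - ?\<phi> 0 \<ge> (g \<bullet> (y - x)) * (1 - 0)"
    by (intro convex_on_imp_above_tangent[where A = UNIV and f = ?\<phi> and x = 1 and c = 0]) auto
  then show ?thesis by simp
qed

lemma convex_on_gradient_monotone:
  fixes f :: "'a::real_inner \<Rightarrow> real"
  assumes "convex_on UNIV f" "GDERIV f x :> g" "GDERIV f y :> g'"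
  shows "0 \<le> (g - g') \<bullet> (x - y)"
  using convex_on_above_gradient[OF assms(1,2), of y] convex_on_above_gradient[OF assms(1,3), of x]
  by (simp add: inner_diff_left inner_diff_right)

lemma strongly_convex_gradient_monotone:
  fixes f :: "'a::real_inner \<Rightarrow> real"
  assumes "convex_on UNIV (\<lambda>x. f x - \<mu> / 2 * (norm x)\<^sup>2)" "GDERIV f x :> g" "GDERIV f y :> g'"
  shows "\<mu> * (norm (x - y))\<^sup>2 \<le> (g - g') \<bullet> (x - y)"
proof -
  have *: "GDERIV (\<lambda>x. f x - \<mu> / 2 * (norm x)\<^sup>2) x :> (g - \<mu> *\<^sub>R x)" if "GDERIV f x :> g" for x g
    unfolding gderiv_def power2_norm_eq_inner using that[unfolded gderiv_def]
    by (auto intro!: derivative_eq_intros simp: inner_diff_right inner_commute algebra_simps)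
  show ?thesis
    using convex_on_gradient_monotone[OF assms(1) *[OF assms(2)] *[OF assms(3)]]
    by (simp add: power2_norm_eq_inner algebra_simps inner_commute)
qed

text \<open>No integral along the segment is needed: subtracting the linear and quadratic terms
  leaves a function of \<open>t\<close> whose derivative is nonpositive on [0,1], by Cauchy-Schwarz
  and the Lipschitz bound.\<close>

lemma lipschitz_gradient_descent:
  fixes f :: "'a::real_inner \<Rightarrow> real"
  assumes gd: "\<And>x. GDERIV f x :> g x" and lip: "L-lipschitz_on UNIV g"
  shows "f y \<le> f x + g x \<bullet> (y - x) + L / 2 * (norm (y - x))\<^sup>2"
proof -
  define d where "d = y - x"
  let ?\<phi> = "\<lambda>t. f (x + t *\<^sub>R d) - t * (g x \<bullet> d) - L / 2 * t\<^sup>2 * (norm d)\<^sup>2"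
  have D: "(?\<phi> has_real_derivative (g (x + t *\<^sub>R d) \<bullet> d - g x \<bullet> d - L * t * (norm d)\<^sup>2)) (at t)" for t
    by (rule derivative_eq_intros gderiv_along_line[OF gd] refl | simp)+
  have "?\<phi> 1 \<le> ?\<phi> 0"
  proof (rule DERIV_nonpos_imp_nonincreasing[of 0 1 ?\<phi>])
    fix t :: real assume t: "0 \<le> t" "t \<le> 1"
    have "(g (x + t *\<^sub>R d) - g x) \<bullet> d \<le> norm (g (x + t *\<^sub>R d) - g x) * norm d"
      by (rule norm_cauchy_schwarz)
    also have "\<dots> \<le> L * norm (t *\<^sub>R d) * norm d"
      using lipschitz_onD[OF lip, of "x + t *\<^sub>R d" x]
      by (intro mult_right_mono) (auto simp: dist_norm)
    also have "\<dots> = L * t * (norm d)\<^sup>2"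
      using t by (simp add: power2_eq_square)
    finally show "\<exists>y. (?\<phi> has_real_derivative y) (at t) \<and> y \<le> 0"
      using D[of t] by (auto simp: inner_diff_left)
  qed simp
  then show ?thesis by (simp add: d_def)
qed

text \<open>Smoothness sharpens the tangent inequality by the squared gradient gap divided by
  \<open>2 * L\<close>; adding the sharpened inequality for both orders of the two points gives
  cocoercivity.\<close>

lemma convex_lipschitz_gradient_cocoercive:
  fixes f :: "'a::real_inner \<Rightarrow> real"
  assumes cvx: "convex_on UNIV f" and gd: "\<And>x. GDERIV f x :> g x"
    and lip: "L-lipschitz_on UNIV g" and L: "L > 0"
  shows "(norm (g x - g y))\<^sup>2 \<le> L * ((g x - g y) \<bullet> (x - y))"
proof -
  have *: "f y + g y \<bullet> (x - y) + (norm (g x - g y))\<^sup>2 / (2 * L) \<le> f x" for x y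
  proof -
    \<comment> \<open>The quadratic upper model of \<open>f\<close> at \<open>x\<close> lies above
      the tangent at \<open>y\<close> everywhere; \<open>z\<close> is the point where their gap is
      smallest.\<close>
    define z where "z = x - (1 / L) *\<^sub>R (g x - g y)"
    have "f y + g y \<bullet> (z - y) \<le> f x + g x \<bullet> (z - x) + L / 2 * (norm (z - x))\<^sup>2"
      using convex_on_above_gradient[OF cvx gd, of y z] lipschitz_gradient_descent[OF gd lip, of z x]
      by linarith
    moreover have "L / 2 * (norm (z - x))\<^sup>2 = (norm (g x - g y))\<^sup>2 / (2 * L)"
      using L by (simp add: z_def power_mult_distrib power2_eq_square)
    moreover have "g x \<bullet> (z - x) - g y \<bullet> (z - x) = - (norm (g x - g y))\<^sup>2 / L"
      by (simp add: z_def power2_norm_eq_inner inner_diff_left inner_diff_right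
          diff_divide_distrib add_divide_distrib algebra_simps)
    moreover have "g y \<bullet> (z - y) = g y \<bullet> (z - x) + g y \<bullet> (x - y)"
      by (simp add: inner_diff_right)
    moreover have "(norm (g x - g y))\<^sup>2 / L = 2 * ((norm (g x - g y))\<^sup>2 / (2 * L))"
      by simp
    ultimately show ?thesis by linarith
  qed
  have "(norm (g x - g y))\<^sup>2 / L \<le> (g x - g y) \<bullet> (x - y)"
    using *[of y x] *[of x y]
    by (simp add: norm_minus_commute[of "g y"] inner_diff_left inner_diff_right)
  then show ?thesis using L by (simp add: field_simps)
qed

lemma power2_norm_mean_le:
  fixes v :: "nat \<Rightarrow> 'a::real_inner"
  shows "(norm ((1 / real M) *\<^sub>R (\<Sum>m=1..M. v m)))\<^sup>2 \<le> 1 / real M * (\<Sum>m=1..M. (norm (v m))\<^sup>2)"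
proof (cases "M = 0")
  case False
  have "(norm (\<Sum>m=1..M. v m))\<^sup>2 \<le> (\<Sum>m=1..M. norm (v m))\<^sup>2"
    by (intro power_mono norm_sum) simp
  also have "\<dots> \<le> real M * (\<Sum>m=1..M. (norm (v m))\<^sup>2)"
    using sum_squared_le_sum_of_squares[of "\<lambda>m. norm (v m)" "{1..M}"] by (simp add: mult.commute)
  finally show ?thesis
    using False by (simp add: power_mult_distrib power2_eq_square field_simps)
qed simp

text \<open>Young's inequality for the positive semidefinite quadratic form
  \<open>q(u) = \<omega> mean |u\<^sub>m|\<^sup>2 - \<zeta> |mean u\<^sub>m|\<^sup>2\<close>: the difference of the two sides is \<open>q(b u + v) / b\<close>.\<close>

lemma young_variance_form:
  fixes u v :: "nat \<Rightarrow> 'a::real_inner" and M :: nat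
  assumes b: "b > 0" and z: "0 \<le> \<zeta>" "\<zeta> \<le> \<omega>"
  defines "q \<equiv> \<lambda>w :: nat \<Rightarrow> 'a. \<omega> * (1 / real M * (\<Sum>m=1..M. (norm (w m))\<^sup>2))
             - \<zeta> * (norm ((1 / real M) *\<^sub>R (\<Sum>m=1..M. w m)))\<^sup>2"
  shows "q (\<lambda>m. u m - v m) \<le> (1 + b) * q u + (1 + 1 / b) * q v"
proof -
  have id: "(norm (x - y))\<^sup>2 = (1 + b) * (norm x)\<^sup>2 + (1 + 1 / b) * (norm y)\<^sup>2
      - 1 / b * (norm (b *\<^sub>R x + y))\<^sup>2" for x y :: 'a
    using b by (simp add: power2_norm_eq_inner inner_add_left inner_add_right inner_diff_left
        inner_diff_right inner_commute field_simps)
  let ?w = "\<lambda>m. b *\<^sub>R u m + v m"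
  have s: "(1 / real M) *\<^sub>R (\<Sum>m=1..M. u m - v m)
      = (1 / real M) *\<^sub>R (\<Sum>m=1..M. u m) - (1 / real M) *\<^sub>R (\<Sum>m=1..M. v m)"
    "(1 / real M) *\<^sub>R (\<Sum>m=1..M. ?w m)
      = b *\<^sub>R ((1 / real M) *\<^sub>R (\<Sum>m=1..M. u m)) + (1 / real M) *\<^sub>R (\<Sum>m=1..M. v m)"
    by (simp_all add: sum_subtractf sum.distrib scaleR_sum_right[symmetric] scaleR_diff_right scaleR_add_right)
  have m: "(\<Sum>m=1..M. (norm (u m - v m))\<^sup>2) = (1 + b) * (\<Sum>m=1..M. (norm (u m))\<^sup>2)
      + (1 + 1 / b) * (\<Sum>m=1..M. (norm (v m))\<^sup>2) - 1 / b * (\<Sum>m=1..M. (norm (?w m))\<^sup>2)"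
    unfolding id[of "u _" "v _"] by (simp only: sum_subtractf sum.distrib sum_distrib_left)
  have "q (\<lambda>m. u m - v m) = (1 + b) * q u + (1 + 1 / b) * q v - 1 / b * q ?w"
    unfolding q_def m s id[of "(1 / real M) *\<^sub>R (\<Sum>m=1..M. u m)"]
    by (simp add: algebra_simps add_divide_distrib)
  moreover have "0 \<le> q ?w"
  proof -
    have "\<zeta> * (norm ((1 / real M) *\<^sub>R (\<Sum>m=1..M. ?w m)))\<^sup>2
        \<le> \<omega> * (1 / real M * (\<Sum>m=1..M. (norm (?w m))\<^sup>2))"
      using z by (intro mult_mono power2_norm_mean_le) auto
    then show ?thesis by (simp add: q_def)
  qed
  then have "0 \<le> 1 / b * q ?w" using b by (intro mult_nonneg_nonneg) auto
  ultimately show ?thesis by linarith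
qed

subsection \<open>The proximal map\<close>

text \<open>\<open>prox_vi R \<gamma> w p\<close> is the first-order optimality condition
  \<open>(w - p) / \<gamma> \<in> \<partial>R(p)\<close> of \<open>p = prox \<gamma> R w\<close>.\<close>

definition prox_vi :: "('a::real_inner \<Rightarrow> ereal) \<Rightarrow> real \<Rightarrow> 'a \<Rightarrow> 'a \<Rightarrow> bool" where
  "prox_vi R \<gamma> w p \<longleftrightarrow>
     (\<exists>r. R p = ereal r \<and> (\<forall>y t. R y \<le> ereal t \<longrightarrow> (w - p) \<bullet> (y - p) \<le> \<gamma> * (t - r)))"

text \<open>Testing each optimality condition at the other point makes the values of
  \<open>R\<close> cancel, which is monotonicity of the subdifferential. Cauchy-Schwarz does the
  rest.\<close>

lemma prox_vi_nonexpansive: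
  assumes "prox_vi R \<gamma> w p" "prox_vi R \<gamma> v q"
  shows "norm (p - q) \<le> norm (w - v)"
proof -
  obtain r where r: "R p = ereal r" "\<And>y t. R y \<le> ereal t \<Longrightarrow> (w - p) \<bullet> (y - p) \<le> \<gamma> * (t - r)"
    using assms(1) unfolding prox_vi_def by blast
  obtain s where s: "R q = ereal s" "\<And>y t. R y \<le> ereal t \<Longrightarrow> (v - q) \<bullet> (y - q) \<le> \<gamma> * (t - s)"
    using assms(2) unfolding prox_vi_def by blast
  have "(w - p) \<bullet> (q - p) + (v - q) \<bullet> (p - q) \<le> 0"
    using r(2)[of q s] s(2)[of p r] r(1) s(1) by (simp add: algebra_simps)
  then have "(norm (p - q))\<^sup>2 \<le> (w - v) \<bullet> (p - q)"
    by (simp add: power2_norm_eq_inner algebra_simps inner_commute)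
  also have "\<dots> \<le> norm (w - v) * norm (p - q)"
    by (rule norm_cauchy_schwarz)
  finally have "norm (p - q) * norm (p - q) \<le> norm (w - v) * norm (p - q)"
    by (simp add: power2_eq_square)
  then show ?thesis
    by (cases "p = q") auto
qed

text \<open>Real upper bounds \<open>r\<close> and \<open>t\<close>, that is, points of the
  epigraph, keep infinite values of \<open>R\<close> out of the arithmetic.\<close>

lemma proper_closed_convex_segment:
  assumes "proper_closed_convex R" "R p \<le> ereal r" "R y \<le> ereal t" "0 \<le> s" "s \<le> 1"
  shows "R (p + s *\<^sub>R (y - p)) \<le> ereal (r + s * (t - r))"
proof -
  have "convex (ereal_epigraph R)" "(p, r) \<in> ereal_epigraph R" "(y, t) \<in> ereal_epigraph R"
    using assms(1-3) by (auto simp: proper_closed_convex_def ereal_epigraph_def)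
  then have "(1 - s) *\<^sub>R (p, r) + s *\<^sub>R (y, t) \<in> ereal_epigraph R"
    using assms(4,5) by (intro convexD_alt) auto
  moreover have "(1 - s) *\<^sub>R (p, r) + s *\<^sub>R (y, t) = (p + s *\<^sub>R (y - p), r + s * (t - r))"
    by (simp add: algebra_simps)
  ultimately show ?thesis by (simp add: ereal_epigraph_def)
qed

lemma right_derivative_nonneg:
  fixes f :: "real \<Rightarrow> real"
  assumes "(f has_real_derivative D) (at 0)" and "\<And>s. 0 < s \<Longrightarrow> s \<le> 1 \<Longrightarrow> f 0 \<le> f s"
  shows "0 \<le> D"
proof (rule ccontr)
  assume "\<not> 0 \<le> D"
  then obtain d where d: "d > 0" "\<And>h. 0 < h \<Longrightarrow> h < d \<Longrightarrow> f (0 + h) < f 0"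
    using DERIV_neg_dec_right[OF assms(1)] by auto
  show False
    using d(2)[of "min 1 (d / 2)"] assms(2)[of "min 1 (d / 2)"] d(1) by (smt (verit) field_sum_of_halves)
qed

text \<open>Fermat's rule along segments, for the sum of \<open>c R\<close> and a differentiable function. With
  \<open>f = F\<close> it gives the subgradient \<open>-\<nabla>F(x\<^sup>\<star>)\<close> of \<open>R\<close>, with a squared distance it
  characterizes the proximal map.\<close>

lemma arg_min_fermat:
  assumes R: "proper_closed_convex R" and c: "c > 0" and f: "GDERIV f p :> g"
    and min: "is_arg_min (\<lambda>x. ereal c * R x + ereal (f x)) (\<lambda>_. True) p"
  shows "\<exists>r. R p = ereal r \<and> (\<forall>y t. R y \<le> ereal t \<longrightarrow> - (g \<bullet> (y - p)) \<le> c * (t - r))"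
proof -
  have le: "ereal c * R p + ereal (f p) \<le> ereal c * R y + ereal (f y)" for y
    using min unfolding is_arg_min_def by (metis not_le)
  obtain y0 where "R y0 \<noteq> \<infinity>" "R y0 \<noteq> - \<infinity>"
    using R by (auto simp: proper_closed_convex_def)
  then have "R p \<noteq> \<infinity>"
    using le[of y0] c by (cases "R y0") auto
  moreover have "R p \<noteq> - \<infinity>"
    using R by (auto simp: proper_closed_convex_def)
  ultimately obtain r where r: "R p = ereal r" by (cases "R p") auto
  have "- (g \<bullet> (y - p)) \<le> c * (t - r)" if yt: "R y \<le> ereal t" for y t
  proof -
    \<comment> \<open>\<open>R\<close> need not be differentiable along the segment. It is replaced
      by its affine upper bound, which agrees with it at \<open>s = 0\<close>, so that minimality at
      0 persists and a derivative exists.\<close>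
    let ?\<phi> = "\<lambda>s. c * (r + s * (t - r)) + f (p + s *\<^sub>R (y - p))"
    have "(?\<phi> has_real_derivative (c * (t - r) + g \<bullet> (y - p))) (at 0)"
      using f by (auto intro!: derivative_eq_intros gderiv_along_line)
    moreover have "?\<phi> 0 \<le> ?\<phi> s" if s: "0 < s" "s \<le> 1" for s
    proof -
      have "R (p + s *\<^sub>R (y - p)) \<le> ereal (r + s * (t - r))"
        using s by (intro proper_closed_convex_segment R yt) (auto simp: r)
      then have "ereal c * R (p + s *\<^sub>R (y - p)) \<le> ereal c * ereal (r + s * (t - r))"
        using c by (intro ereal_mult_left_mono) auto
      then have "ereal c * R (p + s *\<^sub>R (y - p)) + ereal (f (p + s *\<^sub>R (y - p)))
          \<le> ereal c * ereal (r + s * (t - r)) + ereal (f (p + s *\<^sub>R (y - p)))"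
        by (rule add_right_mono)
      from order_trans[OF le this] show ?thesis
        by (simp add: r)
    qed
    ultimately have "0 \<le> c * (t - r) + g \<bullet> (y - p)"
      by (rule right_derivative_nonneg)
    then show ?thesis by linarith
  qed
  with r show ?thesis by blast
qed

lemma gderiv_half_dist_square: "GDERIV (\<lambda>x. (norm (x - w))\<^sup>2 / 2) x :> (x - w)"
  unfolding gderiv_def power2_norm_eq_inner
  by (auto intro!: derivative_eq_intros simp: inner_commute)

text \<open>\<open>prox\<close> is a choice through \<open>arg_min\<close>, so attainment has to be
  proved. Minimizing over the epigraph turns the extended-valued objective into a continuous real
  function on a closed set, and the affine minorant makes its sublevel sets bounded.\<close>

lemma prox_exists:
  fixes R :: "'a::euclidean_space \<Rightarrow> ereal"
  assumes R: "proper_closed_convex R" and \<gamma>: "\<gamma> > 0"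
    and minorant: "\<And>y t. R y \<le> ereal t \<Longrightarrow> \<beta> + g \<bullet> y \<le> t"
  shows "is_arg_min (\<lambda>x. ereal \<gamma> * R x + ereal ((norm (x - w))\<^sup>2 / 2)) (\<lambda>_. True) (prox \<gamma> R w)"
proof -
  let ?\<phi> = "\<lambda>(x, t). \<gamma> * t + (norm (x - w))\<^sup>2 / 2"
  obtain x0 where "R x0 \<noteq> \<infinity>" "R x0 \<noteq> - \<infinity>"
    using R by (auto simp: proper_closed_convex_def)
  then obtain t0 where t0: "R x0 = ereal t0" by (cases "R x0") auto
  define c where "c = ?\<phi> (x0, t0)"
  define K where "K = ereal_epigraph R \<inter> {z. ?\<phi> z \<le> c}"
  have cont: "continuous_on A ?\<phi>" for A
    by (auto intro!: continuous_intros simp: case_prod_beta)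
  have "closed {z. ?\<phi> z \<le> c}"
    by (rule closed_Collect_le[OF cont continuous_on_const])
  then have closedK: "closed K"
    using R unfolding K_def proper_closed_convex_def by blast
  have "bounded K"
  proof -
    \<comment> \<open>Completing the square: \<open>\<gamma>\<close> times the minorant plus half
      the squared distance to \<open>w\<close> is, up to a constant, half the squared distance to
      \<open>w'\<close>. This confines \<open>x\<close> to a ball, and then the minorant and the
      level \<open>c\<close> confine \<open>t\<close>.\<close>
    define w' where "w' = w - \<gamma> *\<^sub>R g"
    define c' where "c' = 2 * (c - \<gamma> * \<beta>) - (norm w)\<^sup>2 + (norm w')\<^sup>2"
    have "K \<subseteq> cball w' (sqrt c') \<times> {\<beta> - norm g * (norm w' + sqrt c') .. c / \<gamma>}"
    proof
      fix z assume "z \<in> K"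
      then obtain x t where z: "z = (x, t)" and xt: "R x \<le> ereal t" and le: "?\<phi> (x, t) \<le> c"
        by (auto simp: K_def ereal_epigraph_def)
      have t: "\<beta> + g \<bullet> x \<le> t" using minorant[OF xt] .
      have "2 * (\<gamma> * (\<beta> + g \<bullet> x)) + (norm (x - w))\<^sup>2 \<le> 2 * c"
        using mult_left_mono[OF t less_imp_le[OF \<gamma>]] le by simp
      then have "(norm (x - w'))\<^sup>2 \<le> c'"
        by (simp add: w'_def c'_def power2_norm_eq_inner algebra_simps inner_commute)
      then have x: "norm (x - w') \<le> sqrt c'"
        by (simp add: real_le_rsqrt)
      then have x': "norm x \<le> norm w' + sqrt c'"
        by (smt (verit) norm_triangle_sub)
      have "- (g \<bullet> x) \<le> norm g * norm x"
        by (smt (verit) Cauchy_Schwarz_ineq2)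
      also have "\<dots> \<le> norm g * (norm w' + sqrt c')"
        using x' by (intro mult_left_mono) auto
      finally have "\<beta> - norm g * (norm w' + sqrt c') \<le> t"
        using t by linarith
      moreover have "t \<le> c / \<gamma>"
      proof -
        have "\<gamma> * t \<le> c"
          using le zero_le_power2[of "norm (x - w)"] unfolding prod.case by linarith
        then show ?thesis using \<gamma> by (simp add: pos_le_divide_eq mult.commute)
      qed
      ultimately show "z \<in> cball w' (sqrt c') \<times> {\<beta> - norm g * (norm w' + sqrt c') .. c / \<gamma>}"
        using x by (simp add: z dist_norm norm_minus_commute)
    qed
    then show ?thesis
      by (rule bounded_subset[rotated]) (intro bounded_Times bounded_cball bounded_closed_interval)
  qed
  with closedK have "compact K"
    by (simp add: compact_eq_bounded_closed)
  moreover have "(x0, t0) \<in> K"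
    by (simp add: K_def ereal_epigraph_def t0 c_def)
  ultimately obtain p r where pr: "(p, r) \<in> K" and min: "\<And>z. z \<in> K \<Longrightarrow> ?\<phi> (p, r) \<le> ?\<phi> z"
    using continuous_attains_inf[of K ?\<phi>] cont by (metis empty_iff surj_pair)
  \<comment> \<open>Outside \<open>K\<close> the objective exceeds the level \<open>c\<close>, hence
    also the value at \<open>(p, r)\<close>.\<close>
  have min': "?\<phi> (p, r) \<le> ?\<phi> z" if "z \<in> ereal_epigraph R" for z
    using min[of z] pr that by (cases "?\<phi> z \<le> c") (auto simp: K_def)
  have "ereal \<gamma> * R p + ereal ((norm (p - w))\<^sup>2 / 2) \<le> ereal \<gamma> * R y + ereal ((norm (y - w))\<^sup>2 / 2)" for y
  proof (cases "R y")
    case (real s)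
    have "ereal \<gamma> * R p + ereal ((norm (p - w))\<^sup>2 / 2) \<le> ereal \<gamma> * ereal r + ereal ((norm (p - w))\<^sup>2 / 2)"
      using pr \<gamma> by (intro add_right_mono ereal_mult_left_mono) (auto simp: K_def ereal_epigraph_def)
    also have "\<dots> \<le> ereal \<gamma> * R y + ereal ((norm (y - w))\<^sup>2 / 2)"
      using min'[of "(y, s)"] real by (simp add: ereal_epigraph_def)
    finally show ?thesis .
  next
    case PInf
    then show ?thesis using \<gamma> by simp
  next
    case MInf
    then show ?thesis using R by (auto simp: proper_closed_convex_def)
  qed
  then have "is_arg_min (\<lambda>x. ereal \<gamma> * R x + ereal ((norm (x - w))\<^sup>2 / 2)) (\<lambda>_. True) p"
    by (auto simp: is_arg_min_def not_less)
  then show ?thesis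
    unfolding prox_def arg_min_def by (rule someI)
qed

text \<open>The minimizer \<open>x\<^sup>\<star>\<close> of \<open>R + F\<close> provides the affine minorant of \<open>R\<close> that makes the
  proximal subproblem coercive.\<close>

lemma prox_vi_prox:
  fixes R :: "'a::euclidean_space \<Rightarrow> ereal"
  assumes R: "proper_closed_convex R" and \<gamma>: "\<gamma> > 0" and F: "GDERIV F xs :> g"
    and xs: "is_arg_min (\<lambda>x. R x + ereal (F x)) (\<lambda>_. True) xs"
  shows "prox_vi R \<gamma> w (prox \<gamma> R w)" and "prox_vi R \<gamma> (xs - \<gamma> *\<^sub>R g) xs"
proof -
  obtain r where r: "R xs = ereal r"
    and sub: "\<And>y t. R y \<le> ereal t \<Longrightarrow> - (g \<bullet> (y - xs)) \<le> t - r"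
    using arg_min_fermat[OF R zero_less_one F] xs by (auto simp: one_ereal_def[symmetric])
  have "is_arg_min (\<lambda>x. ereal \<gamma> * R x + ereal ((norm (x - w))\<^sup>2 / 2)) (\<lambda>_. True) (prox \<gamma> R w)"
  proof (rule prox_exists[OF R \<gamma>])
    show "(r + g \<bullet> xs) + (- g) \<bullet> y \<le> t" if "R y \<le> ereal t" for y t
      using sub[OF that] by (simp add: inner_diff_right)
  qed
  from arg_min_fermat[OF R \<gamma> gderiv_half_dist_square this]
  show "prox_vi R \<gamma> w (prox \<gamma> R w)"
    unfolding prox_vi_def by (simp add: inner_minus_left[symmetric])
  have "(xs - \<gamma> *\<^sub>R g - xs) \<bullet> (y - xs) \<le> \<gamma> * (t - r)" if "R y \<le> ereal t" for y t
    using mult_left_mono[OF sub[OF that] less_imp_le[OF \<gamma>]] by simp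
  with r show "prox_vi R \<gamma> (xs - \<gamma> *\<^sub>R g) xs"
    unfolding prox_vi_def by blast
qed

subsection \<open>Unbiased operators and independence\<close>

lemma (in prob_space) second_moment_shift:
  fixes Z :: "'a \<Rightarrow> 'b::euclidean_space"
  assumes Z: "integrable M Z" "expectation Z = 0" and Z2: "integrable M (\<lambda>s. (norm (Z s))\<^sup>2)"
  shows "integrable M (\<lambda>s. (norm (w + r *\<^sub>R Z s))\<^sup>2)"
    and "expectation (\<lambda>s. (norm (w + r *\<^sub>R Z s))\<^sup>2) = (norm w)\<^sup>2 + r\<^sup>2 * expectation (\<lambda>s. (norm (Z s))\<^sup>2)"
proof -
  have eq: "(norm (w + r *\<^sub>R Z s))\<^sup>2 = (norm w)\<^sup>2 + 2 * r * (w \<bullet> Z s) + r\<^sup>2 * (norm (Z s))\<^sup>2" for s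
    unfolding power2_norm_eq_inner
    by (simp add: inner_add_left inner_add_right inner_commute power2_eq_square algebra_simps)
  have int: "integrable M (\<lambda>s. w \<bullet> Z s)" "expectation (\<lambda>s. w \<bullet> Z s) = 0"
    using Z by simp_all
  show "integrable M (\<lambda>s. (norm (w + r *\<^sub>R Z s))\<^sup>2)"
    unfolding eq using int(1) Z2 by simp
  show "expectation (\<lambda>s. (norm (w + r *\<^sub>R Z s))\<^sup>2) = (norm w)\<^sup>2 + r\<^sup>2 * expectation (\<lambda>s. (norm (Z s))\<^sup>2)"
    unfolding eq using int Z2 by (simp add: prob_space)
qed

lemma (in prob_space) unbiased_op_centered:
  fixes T :: "'a \<Rightarrow> 'b::euclidean_space \<Rightarrow> 'b"
  assumes "unbiased_op M \<omega> T"
  shows "integrable M (\<lambda>s. T s v - v)" "expectation (\<lambda>s. T s v - v) = 0"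
    "integrable M (\<lambda>s. (norm (T s v - v))\<^sup>2)"
    "expectation (\<lambda>s. (norm (T s v - v))\<^sup>2) \<le> \<omega> * (norm v)\<^sup>2"
  using assms by (simp_all add: unbiased_op_def prob_space)

text \<open>With relaxation \<open>1 / (1 + \<omega>)\<close> the variance turns \<open>|y + v / (1 + \<omega>)|\<^sup>2\<close> exactly into the
  convex combination of \<open>|y|\<^sup>2\<close> and \<open>|y + v|\<^sup>2\<close>.\<close>

lemma (in prob_space) unbiased_op_relaxed_step:
  fixes T :: "'a \<Rightarrow> 'b::euclidean_space \<Rightarrow> 'b"
  assumes T: "unbiased_op M \<omega> T" and \<omega>: "\<omega> \<ge> 0" and r: "r = 1 / (1 + \<omega>)"
  shows "integrable M (\<lambda>s. (norm (y + r *\<^sub>R T s v))\<^sup>2)"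
    and "expectation (\<lambda>s. (norm (y + r *\<^sub>R T s v))\<^sup>2) \<le> (1 - r) * (norm y)\<^sup>2 + r * (norm (y + v))\<^sup>2"
proof -
  note Z = unbiased_op_centered[OF T, of v]
  have eq: "y + r *\<^sub>R T s v = (y + r *\<^sub>R v) + r *\<^sub>R (T s v - v)" for s
    by (simp add: algebra_simps)
  show "integrable M (\<lambda>s. (norm (y + r *\<^sub>R T s v))\<^sup>2)"
    unfolding eq by (rule second_moment_shift(1)[OF Z(1-3)])
  have "expectation (\<lambda>s. (norm (y + r *\<^sub>R T s v))\<^sup>2) \<le> (norm (y + r *\<^sub>R v))\<^sup>2 + r\<^sup>2 * (\<omega> * (norm v)\<^sup>2)"
    unfolding eq second_moment_shift(2)[OF Z(1-3)]
    using mult_left_mono[OF Z(4), of "r\<^sup>2"] by simp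
  also have "\<dots> = (norm y)\<^sup>2 + 2 * r * (y \<bullet> v) + (r * (1 + \<omega>)) * r * (norm v)\<^sup>2"
    unfolding power2_norm_eq_inner
    by (simp add: inner_add_left inner_add_right inner_commute power2_eq_square algebra_simps)
  also have "r * (1 + \<omega>) = 1"
    using \<omega> r by simp
  also have "(norm y)\<^sup>2 + 2 * r * (y \<bullet> v) + 1 * r * (norm v)\<^sup>2
      = (1 - r) * (norm y)\<^sup>2 + r * (norm (y + v))\<^sup>2"
    by (simp add: power2_norm_eq_inner inner_add_left inner_add_right inner_commute algebra_simps)
  finally show "expectation (\<lambda>s. (norm (y + r *\<^sub>R T s v))\<^sup>2) \<le> (1 - r) * (norm y)\<^sup>2 + r * (norm (y + v))\<^sup>2" .
qed

text \<open>This replaces conditioning: a quantity that depends on the fresh randomness \<open>s\<close> and on a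
  past \<open>s'\<close> is evaluated on the diagonal, but integrates as if \<open>s\<close> and \<open>s'\<close> were independent.\<close>

lemma (in prob_space) nn_integral_indep_subalgebras:
  assumes sub: "subalgebra M G" "subalgebra M H" and ind: "indep_set (sets G) (sets H)"
    and f: "(\<lambda>(s, s'). f s s') \<in> borel_measurable (G \<Otimes>\<^sub>M H)"
  shows "(\<integral>\<^sup>+ s. f s s \<partial>M) = (\<integral>\<^sup>+ s'. (\<integral>\<^sup>+ s. f s s' \<partial>M) \<partial>M)"
proof -
  \<comment> \<open>The identity, read as a map into \<open>G\<close> or into \<open>H\<close>, is a
    random variable that generates exactly this sigma-algebra. Independence of the sigma-algebras
    then says that the law of the diagonal map is a product measure, to which Fubini
    applies.\<close>
  have m: "(\<lambda>x. x) \<in> measurable M G" "(\<lambda>x. x) \<in> measurable M H"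
    by (rule measurable_from_subalg[OF sub(1) measurable_ident[unfolded id_def]],
        rule measurable_from_subalg[OF sub(2) measurable_ident[unfolded id_def]])
  have s: "sigma_sets (space M) {(\<lambda>x. x) -` A \<inter> space M |A. A \<in> sets N} = sets N"
    if N: "subalgebra M N" for N
  proof -
    have sp: "space N = space M" using N by (simp add: subalgebra_def)
    have "(\<lambda>x. x) -` A \<inter> space M = A" if "A \<in> sets N" for A
      using sets.sets_into_space[OF that] sp by auto
    then have "{(\<lambda>x. x) -` A \<inter> space M |A. A \<in> sets N} = (\<lambda>A. A) ` sets N"
      unfolding Setcompr_eq_image by (rule image_cong[OF refl])
    then show ?thesis
      using sets.sigma_sets_eq[of N] sp by simp
  qed
  have "indep_var G (\<lambda>x. x) H (\<lambda>x. x)"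
    unfolding indep_var_eq s[OF sub(1)] s[OF sub(2)] using m ind by blast
  then have d: "distr M G (\<lambda>x. x) \<Otimes>\<^sub>M distr M H (\<lambda>x. x) = distr M (G \<Otimes>\<^sub>M H) (\<lambda>x. (x, x))"
    by (simp add: indep_var_distribution_eq)
  interpret G: prob_space "distr M G (\<lambda>x. x)" by (rule prob_space_distr[OF m(1)])
  interpret H: prob_space "distr M H (\<lambda>x. x)" by (rule prob_space_distr[OF m(2)])
  interpret GH: pair_sigma_finite "distr M G (\<lambda>x. x)" "distr M H (\<lambda>x. x)" ..
  have f': "(\<lambda>(s, s'). f s s') \<in> borel_measurable (distr M G (\<lambda>x. x) \<Otimes>\<^sub>M distr M H (\<lambda>x. x))"
    using f by (simp cong: measurable_cong_sets sets_pair_measure_cong)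
  have "(\<integral>\<^sup>+ s. f s s \<partial>M) = (\<integral>\<^sup>+ z. (case z of (s, s') \<Rightarrow> f s s') \<partial>distr M (G \<Otimes>\<^sub>M H) (\<lambda>x. (x, x)))"
    using m f by (subst nn_integral_distr) auto
  also have "\<dots> = (\<integral>\<^sup>+ s'. (\<integral>\<^sup>+ s. f s s' \<partial>distr M G (\<lambda>x. x)) \<partial>distr M H (\<lambda>x. x))"
    unfolding d[symmetric] using GH.nn_integral_snd[OF f'] by simp
  also have "\<dots> = (\<integral>\<^sup>+ s'. (\<integral>\<^sup>+ s. f s s' \<partial>distr M G (\<lambda>x. x)) \<partial>M)"
    using f' by (intro nn_integral_distr m) (auto intro!: G.borel_measurable_nn_integral
        measurable_compose[OF measurable_pair_swap' f] simp: case_prod_beta)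
  also have "\<dots> = (\<integral>\<^sup>+ s'. (\<integral>\<^sup>+ s. f s s' \<partial>M) \<partial>M)"
  proof (rule nn_integral_cong)
    fix s' assume "s' \<in> space M"
    then have "s' \<in> space H" using sub(2) by (simp add: subalgebra_def)
    from measurable_compose[OF measurable_Pair2'[OF this] f]
    show "(\<integral>\<^sup>+ s. f s s' \<partial>distr M G (\<lambda>x. x)) = (\<integral>\<^sup>+ s. f s s' \<partial>M)"
      by (intro nn_integral_distr m) simp
  qed
  finally show ?thesis .
qed

text \<open>The carrier is \<open>space P\<close> even for empty \<open>I\<close>; the trivial
  sigma-algebra obtained then serves the deterministic starting point.\<close>

definition join_alg :: "'w measure \<Rightarrow> ('i \<Rightarrow> 'w measure) \<Rightarrow> 'i set \<Rightarrow> 'w measure" where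
  "join_alg P N I = sigma (space P) (\<Union>i\<in>I. sets (N i))"

lemma
  assumes "\<And>i. subalgebra P (N i)"
  shows space_join_alg: "space (join_alg P N I) = space P"
    and sets_join_alg: "sets (join_alg P N I) = sigma_sets (space P) (\<Union>i\<in>I. sets (N i))"
    and subalgebra_join_alg: "subalgebra P (join_alg P N I)"
proof -
  have sub: "(\<Union>i\<in>I. sets (N i)) \<subseteq> sets P"
    using assms by (auto simp: subalgebra_def)
  then have pow: "(\<Union>i\<in>I. sets (N i)) \<subseteq> Pow (space P)"
    using sets.space_closed by blast
  show "space (join_alg P N I) = space P"
    unfolding join_alg_def using pow by (rule space_measure_of)
  show *: "sets (join_alg P N I) = sigma_sets (space P) (\<Union>i\<in>I. sets (N i))"
    unfolding join_alg_def using pow by (rule sets_measure_of)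
  show "subalgebra P (join_alg P N I)"
    unfolding subalgebra_def * \<open>space (join_alg P N I) = space P\<close>
    using sets.sigma_sets_subset[OF sub] by simp
qed

lemma measurable_ident_join_alg:
  assumes "\<And>i. subalgebra P (N i)" "i \<in> I"
  shows "(\<lambda>s. s) \<in> measurable (join_alg P N I) (N i)"
proof (rule measurableI)
  fix A assume A: "A \<in> sets (N i)"
  then have "A \<subseteq> space P"
    using assms(1)[of i] sets.sets_into_space[of A "N i"] by (auto simp: subalgebra_def)
  then show "(\<lambda>s. s) -` A \<inter> space (join_alg P N I) \<in> sets (join_alg P N I)"
    using A assms(2) by (auto simp: space_join_alg[OF assms(1)] sets_join_alg[OF assms(1)] Int_absorb2
        intro!: sigma_sets.Basic)
qed (use assms(1)[of i] in \<open>simp add: space_join_alg[OF assms(1)] subalgebra_def\<close>)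

lemma measurable_join_alg_mono:
  assumes "\<And>i. subalgebra P (N i)" "I \<subseteq> J" "f \<in> measurable (join_alg P N I) K"
  shows "f \<in> measurable (join_alg P N J) K"
proof (rule measurable_from_subalg[OF _ assms(3)])
  have "(\<Union>i\<in>I. sets (N i)) \<subseteq> (\<Union>i\<in>J. sets (N i))"
    using assms(2) by auto
  then show "subalgebra (join_alg P N J) (join_alg P N I)"
    by (simp add: subalgebra_def space_join_alg[OF assms(1)] sets_join_alg[OF assms(1)] sigma_sets_mono')
qed

text \<open>The independent family is grouped into the disjoint blocks \<open>{i}\<close> and
  \<open>J\<close>; grouping preserves independence because sigma-algebras are stable under
  intersection.\<close>

lemma (in prob_space) indep_set_join_alg:
  assumes sub: "\<And>i. subalgebra M (N i)" and ind: "indep_sets (\<lambda>i. sets (N i)) UNIV"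
    and disj: "i \<notin> J"
  shows "indep_set (sets (N i)) (sets (join_alg M N J))"
proof -
  have "indep_sets (\<lambda>j. sigma_sets (space M) (\<Union>k\<in>case_bool {i} J j. sets (N k))) UNIV"
  proof (rule indep_sets_collect_sigma)
    show "indep_sets (\<lambda>i. sets (N i)) (\<Union>j\<in>UNIV. case_bool {i} J j)"
      by (rule indep_sets_mono_index[OF _ ind]) simp
    show "disjoint_family_on (case_bool {i} J) UNIV"
      using disj by (auto simp: disjoint_family_on_def split: bool.split)
  qed (rule sets.Int_stable)
  moreover have "sigma_sets (space M) (sets (N i)) = sets (N i)"
    using sub[of i] sets.sigma_sets_eq[of "N i"] by (simp add: subalgebra_def)
  ultimately show ?thesis
    unfolding indep_set_def sets_join_alg[OF sub]
    by (elim indep_sets_cong[THEN iffD1, rotated -1]) (auto split: bool.split)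
qed

subsection \<open>One step of DIANA\<close>

abbreviation (input) vmean :: "nat \<Rightarrow> (nat \<Rightarrow> 'a::real_vector) \<Rightarrow> 'a" where
  "vmean M v \<equiv> (1 / real M) *\<^sub>R (\<Sum>m=1..M. v m)"

abbreviation (input) rmean :: "nat \<Rightarrow> (nat \<Rightarrow> real) \<Rightarrow> real" where
  "rmean M f \<equiv> 1 / real M * (\<Sum>m=1..M. f m)"

lemma rmean_mono: "(\<And>m. m \<in> {1..M} \<Longrightarrow> f m \<le> g m) \<Longrightarrow> rmean M f \<le> rmean M g"
  by (intro mult_left_mono sum_mono) auto

text \<open>Here \<open>A\<close> is the coefficient of the memory term in the Lyapunov function. The identity
  \<open>A lam / b\<^sup>2 = \<rho> \<gamma>\<^sup>2 (1 + 1 / b) \<omega>\<close> lets the contraction of \<open>H\<close> absorb the variance, and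
  \<open>b + 1 + b\<^sup>2 + b = (1 + b)\<^sup>2\<close> collects the terms in \<open>G\<close>.\<close>

lemma diana_step_arith:
  fixes D H G U p E1 E2 :: real
  assumes E1: "E1 \<le> D - 2 * \<gamma> * p + \<gamma>\<^sup>2 * U
        + \<gamma>\<^sup>2 * ((1 + b) * (\<omega> * G - \<zeta> * U) + (1 + 1 / b) * (\<omega> * H))"
    and E2: "E2 \<le> (1 - lam) * H + lam * G"
    and U: "0 \<le> U" "U \<le> G" and G: "G \<le> L * p" and p: "\<mu> * D \<le> p"
    and D: "0 \<le> D" and H: "0 \<le> H" and b: "b > 1" and \<gamma>: "\<gamma> > 0" and \<omega>: "\<omega> \<ge> 0"
    and step: "\<gamma> * L * (max (1 - (1 + b) * \<zeta>) 0 + (1 + b)\<^sup>2 * \<omega>) \<le> 1"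
    and L: "L > 0" and mu: "\<mu> > 0" and lam: "lam > 0" and \<rho>: "\<rho> > 0"
    and A: "A = (b\<^sup>2 + b) * \<gamma>\<^sup>2 * \<omega> * (\<rho> / lam)"
  shows "(1 - \<rho>) * D + \<rho> * E1 + A * E2
      \<le> (1 - min (\<gamma> * \<mu> * \<rho>) ((1 - 1 / b\<^sup>2) * lam)) * (D + A * H)"
proof -
  \<comment> \<open>Roles of the variables: \<open>D\<close> is the squared distance to the optimum,
    \<open>H\<close> the mean squared memory error, \<open>G\<close> the mean squared gradient gap,
    \<open>U\<close> the squared norm of the mean gap, and \<open>p\<close> its inner product with
    the displacement. \<open>E1\<close> and \<open>E2\<close> are the expectations for the proximal
    point and the new memory.\<close>
  define a where "a = max (1 - (1 + b) * \<zeta>) 0"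
  have A0: "0 \<le> A"
    unfolding A using b \<omega> lam \<rho> by (intro mult_nonneg_nonneg) auto
  have Al: "A * lam = \<rho> * \<gamma>\<^sup>2 * ((b\<^sup>2 + b) * \<omega>)"
    unfolding A using lam by simp
  have Ab: "\<rho> * \<gamma>\<^sup>2 * ((1 + 1 / b) * \<omega>) = A * lam / b\<^sup>2"
    unfolding Al using b by (simp add: field_simps power2_eq_square)
  \<comment> \<open>The coefficient of \<open>U\<close> may have either sign. Its positive part
    \<open>a\<close> is needed before \<open>U\<close> can be replaced by the larger
    \<open>G\<close>.\<close>
  have aU: "(1 - (1 + b) * \<zeta>) * U \<le> a * G"
  proof -
    have "(1 - (1 + b) * \<zeta>) * U \<le> a * U"
      using U by (intro mult_right_mono) (auto simp: a_def)
    also have "\<dots> \<le> a * G" using U by (intro mult_left_mono) (auto simp: a_def)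
    finally show ?thesis .
  qed
  have G0: "0 \<le> G" using U by simp
  \<comment> \<open>Cocoercivity and the step size bound spend one of the two copies of
    \<open>\<gamma> * p\<close> provided by the gradient step; the other is kept for strong
    convexity.\<close>
  have gG: "\<gamma>\<^sup>2 * ((a + (1 + b)\<^sup>2 * \<omega>) * G) \<le> \<gamma> * p"
  proof -
    have a0: "0 \<le> a + (1 + b)\<^sup>2 * \<omega>" using \<omega> by (simp add: a_def)
    have "\<gamma>\<^sup>2 * ((a + (1 + b)\<^sup>2 * \<omega>) * G) \<le> \<gamma>\<^sup>2 * ((a + (1 + b)\<^sup>2 * \<omega>) * (L * p))"
      using G a0 by (intro mult_left_mono) auto
    also have "\<dots> = (\<gamma> * L * (a + (1 + b)\<^sup>2 * \<omega>)) * (\<gamma> * p)"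
      by (simp add: power2_eq_square)
    also have "\<dots> \<le> 1 * (\<gamma> * p)"
      using step p mu D \<gamma> order_trans[OF _ p, of 0] by (intro mult_right_mono) (auto simp: a_def)
    finally show ?thesis by simp
  qed
  have "\<rho> * E1 + A * E2 \<le> \<rho> * (D - 2 * \<gamma> * p + \<gamma>\<^sup>2 * U
        + \<gamma>\<^sup>2 * ((1 + b) * (\<omega> * G - \<zeta> * U) + (1 + 1 / b) * (\<omega> * H)))
      + A * ((1 - lam) * H + lam * G)"
    using E1 E2 A0 \<rho> by (intro add_mono mult_left_mono) auto
  also have "\<dots> = \<rho> * (D - 2 * \<gamma> * p + \<gamma>\<^sup>2 * ((1 - (1 + b) * \<zeta>) * U)) + \<rho> * \<gamma>\<^sup>2 * ((1 + b) * \<omega> * G)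
      + (\<rho> * \<gamma>\<^sup>2 * ((1 + 1 / b) * \<omega>)) * H + A * (1 - lam) * H + (A * lam) * G"
    by (simp add: algebra_simps)
  also have "\<dots> = \<rho> * (D - 2 * \<gamma> * p + \<gamma>\<^sup>2 * ((1 - (1 + b) * \<zeta>) * U)
        + \<gamma>\<^sup>2 * ((1 + b)\<^sup>2 * \<omega> * G)) + A * H * (1 - (1 - 1 / b\<^sup>2) * lam)"
  proof -
    have "A * lam / b\<^sup>2 * H + A * (1 - lam) * H = A * H * (1 - (1 - 1 / b\<^sup>2) * lam)"
      by (simp add: algebra_simps)
    moreover have "\<rho> * \<gamma>\<^sup>2 * ((1 + b) * \<omega> * G) + (A * lam) * G
        = \<rho> * (\<gamma>\<^sup>2 * ((1 + b)\<^sup>2 * \<omega> * G))"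
      unfolding Al by (simp add: algebra_simps power2_eq_square)
    ultimately show ?thesis
      unfolding Ab distrib_left[of \<rho>] by linarith
  qed
  also have "\<dots> \<le> \<rho> * (D - 2 * \<gamma> * p + \<gamma>\<^sup>2 * (a * G) + \<gamma>\<^sup>2 * ((1 + b)\<^sup>2 * \<omega> * G))
      + A * H * (1 - (1 - 1 / b\<^sup>2) * lam)"
    using aU \<rho> by (intro add_mono mult_left_mono order_refl) auto
  also have "\<dots> \<le> \<rho> * (D - \<gamma> * (\<mu> * D)) + A * H * (1 - (1 - 1 / b\<^sup>2) * lam)"
  proof -
    have "D - 2 * \<gamma> * p + \<gamma>\<^sup>2 * (a * G) + \<gamma>\<^sup>2 * ((1 + b)\<^sup>2 * \<omega> * G) \<le> D - \<gamma> * (\<mu> * D)"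
      using gG mult_left_mono[OF p less_imp_le[OF \<gamma>]] by (simp add: algebra_simps)
    then show ?thesis using \<rho> by (simp add: mult_left_mono)
  qed
  finally have "(1 - \<rho>) * D + \<rho> * E1 + A * E2
      \<le> (1 - \<gamma> * \<mu> * \<rho>) * D + (1 - (1 - 1 / b\<^sup>2) * lam) * (A * H)"
    by (simp add: algebra_simps)
  also have "\<dots> \<le> (1 - min (\<gamma> * \<mu> * \<rho>) ((1 - 1 / b\<^sup>2) * lam)) * D
      + (1 - min (\<gamma> * \<mu> * \<rho>) ((1 - 1 / b\<^sup>2) * lam)) * (A * H)"
    using D A0 H by (intro add_mono mult_right_mono) auto
  finally show ?thesis by (simp add: distrib_left)
qed

text \<open>The step size bound is stored with its denominator cleared, the form in which the
  one-step arithmetic consumes it.\<close>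

locale diana_setup = prob_space P for P :: "'w measure" +
  fixes M :: nat
    and F :: "nat \<Rightarrow> 'a::euclidean_space \<Rightarrow> real"
    and gradF :: "nat \<Rightarrow> 'a \<Rightarrow> 'a"
    and R :: "'a \<Rightarrow> ereal"
    and L \<mu> \<omega>C \<omega>R \<omega>av \<zeta> \<gamma> b :: real
    and xs :: 'a
    and C :: "nat \<Rightarrow> nat \<Rightarrow> 'w \<Rightarrow> 'a \<Rightarrow> 'a"
    and Q :: "nat \<Rightarrow> 'w \<Rightarrow> 'a \<Rightarrow> 'a"
  assumes M: "M \<ge> 1"
    and L: "L > 0"
    and mu: "\<mu> > 0"
    and F_convex: "m \<in> {1..M} \<Longrightarrow> convex_on UNIV (F m)"
    and F_grad: "m \<in> {1..M} \<Longrightarrow> GDERIV (F m) x :> gradF m x"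
    and F_smooth: "m \<in> {1..M} \<Longrightarrow> L-lipschitz_on UNIV (gradF m)"
    and F_strong: "convex_on UNIV (\<lambda>x. rmean M (\<lambda>m. F m x) - \<mu> / 2 * (norm x)\<^sup>2)"
    and R: "proper_closed_convex R"
    and xs: "is_arg_min (\<lambda>x. R x + ereal (rmean M (\<lambda>m. F m x))) (\<lambda>_. True) xs"
    and omegas: "\<omega>C \<ge> 0" "\<omega>R \<ge> 0" "0 \<le> \<omega>av" "\<omega>av \<le> \<omega>C" "0 \<le> \<zeta>" "\<zeta> \<le> \<omega>av"
    and indep: "indep_random_maps P M C Q"
    and C: "m \<in> {1..M} \<Longrightarrow> unbiased_op P \<omega>C (C k m)"
    and Q: "unbiased_op P \<omega>R (Q k)"
    and C_av: "(\<integral>s. (norm (vmean M (\<lambda>m. C k m s (v m) - v m)))\<^sup>2 \<partial>P)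
        \<le> \<omega>av / real M * (\<Sum>m=1..M. (norm (v m))\<^sup>2) - \<zeta> * (norm (vmean M v))\<^sup>2"
    and b: "b > 1"
    and gamma: "0 < \<gamma>" "\<gamma> * L * (max (1 - (1 + b) * \<zeta>) 0 + (1 + b)\<^sup>2 * \<omega>av) \<le> 1"
begin

definition lam :: real where "lam = 1 / (1 + \<omega>C)"
definition rho :: real where "rho = 1 / (1 + \<omega>R)"
definition rate :: real where "rate = 1 - min (\<gamma> * \<mu> * rho) ((1 - 1 / b\<^sup>2) * lam)"
definition coef :: real where "coef = (b\<^sup>2 + b) * \<gamma>\<^sup>2 * \<omega>av * (rho / lam)"

lemma lam_pos: "0 < lam" and lam_le_1: "lam \<le> 1" and rho_pos: "0 < rho" and rho_le_1: "rho \<le> 1"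
  using omegas by (auto simp: lam_def rho_def)

lemma coef_nonneg: "0 \<le> coef"
  unfolding coef_def using b omegas lam_pos rho_pos by (intro mult_nonneg_nonneg) auto

lemma contraction_H_bounds: "0 < (1 - 1 / b\<^sup>2) * lam" "(1 - 1 / b\<^sup>2) * lam \<le> 1"
proof -
  have "1 < b\<^sup>2" using b by (rule one_less_power) simp
  then have "0 < 1 - 1 / b\<^sup>2" "1 - 1 / b\<^sup>2 \<le> 1" using b by (auto simp: divide_less_eq)
  then show "0 < (1 - 1 / b\<^sup>2) * lam" "(1 - 1 / b\<^sup>2) * lam \<le> 1"
    using lam_pos lam_le_1 by (auto intro: mult_le_one)
qed

text \<open>Nonnegativity comes from the second entry of the minimum, which is at most 1.\<close>

lemma rate_less_1: "rate < 1" and rate_nonneg: "0 \<le> rate"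
  using contraction_H_bounds gamma(1) mu rho_pos by (auto simp: rate_def)

lemma gradient_mean: "GDERIV (\<lambda>x. rmean M (\<lambda>m. F m x)) x :> vmean M (\<lambda>m. gradF m x)"
  unfolding gderiv_def inner_scaleR_right inner_sum_right
  using F_grad[unfolded gderiv_def]
  by (intro has_derivative_mult_right has_derivative_sum) auto

lemma gradient_mean_cocoercive:
  "rmean M (\<lambda>m. (norm (gradF m x - gradF m y))\<^sup>2)
    \<le> L * (vmean M (\<lambda>m. gradF m x - gradF m y) \<bullet> (x - y))"
proof -
  have "rmean M (\<lambda>m. (norm (gradF m x - gradF m y))\<^sup>2)
      \<le> rmean M (\<lambda>m. L * ((gradF m x - gradF m y) \<bullet> (x - y)))"
    using convex_lipschitz_gradient_cocoercive[OF F_convex F_grad F_smooth L]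
    by (intro rmean_mono) auto
  also have "\<dots> = L * (vmean M (\<lambda>m. gradF m x - gradF m y) \<bullet> (x - y))"
    unfolding inner_scaleR_left inner_sum_left sum_distrib_left[symmetric] by simp
  finally show ?thesis .
qed

lemma vmean_diff: "vmean M (\<lambda>m. u m - v m) = vmean M u - vmean M v" for u v :: "nat \<Rightarrow> 'a"
  by (simp add: sum_subtractf scaleR_diff_right)

lemma gradient_mean_monotone:
  "\<mu> * (norm (x - y))\<^sup>2 \<le> vmean M (\<lambda>m. gradF m x - gradF m y) \<bullet> (x - y)"
  unfolding vmean_diff
  by (rule strongly_convex_gradient_monotone[OF F_strong gradient_mean gradient_mean])

text \<open>Strong monotonicity and the Lipschitz bound are compared along one unit vector. The
  resulting bound of 1 below the condition number lets it absorb additive constants in the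
  complexity estimate.\<close>

lemma mu_le_L: "\<mu> \<le> L"
proof -
  obtain e :: 'a where e: "e \<in> Basis" using nonempty_Basis by blast
  let ?v = "vmean M (\<lambda>m. gradF m e - gradF m 0)"
  have "\<mu> \<le> ?v \<bullet> e"
    using gradient_mean_monotone[of e 0] e by simp
  also have "?v \<bullet> e \<le> norm ?v"
    using norm_cauchy_schwarz[of ?v e] e by simp
  also have "norm ?v = 1 / real M * norm (\<Sum>m=1..M. gradF m e - gradF m 0)"
    by simp
  also have "\<dots> \<le> rmean M (\<lambda>m. norm (gradF m e - gradF m 0))"
    by (intro mult_left_mono norm_sum) simp
  also have "\<dots> \<le> rmean M (\<lambda>m. L)"
    using lipschitz_onD[OF F_smooth, of _ e 0] e by (intro rmean_mono) (auto simp: dist_norm)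
  also have "\<dots> = L" using M by simp
  finally show ?thesis .
qed

lemma prox_nonexpansive: "norm (prox \<gamma> R w - prox \<gamma> R v) \<le> norm (w - v)"
  using prox_vi_nonexpansive prox_vi_prox(1)[OF R gamma(1) gradient_mean xs] by blast

text \<open>Nonexpansiveness holds for any solutions of the optimality conditions, so it applies to
  \<open>xs\<close> directly, without identifying \<open>xs\<close> with the point chosen by
  \<open>prox\<close>.\<close>

lemma prox_dist_optimum:
  "norm (prox \<gamma> R w - xs) \<le> norm (w - (xs - \<gamma> *\<^sub>R vmean M (\<lambda>m. gradF m xs)))"
  using prox_vi_nonexpansive prox_vi_prox[OF R gamma(1) gradient_mean xs] by blast

text \<open>\<open>C_av\<close> bounds a Bochner integral and so does not yield integrability. That
  comes from the individual variances by convexity of the squared norm, whatever the dependence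
  between the compressors.\<close>

lemma compression_error_mean:
  fixes v :: "nat \<Rightarrow> 'a" and k :: nat
  defines "Z \<equiv> \<lambda>s. vmean M (\<lambda>m. C k m s (v m) - v m)"
  shows "integrable P Z" "expectation Z = 0" "integrable P (\<lambda>s. (norm (Z s))\<^sup>2)"
proof -
  note c = unbiased_op_centered[OF C]
  show int: "integrable P Z"
    unfolding Z_def by (intro integrable_scaleR_right Bochner_Integration.integrable_sum c(1))
  show "expectation Z = 0"
    unfolding Z_def by (simp add: Bochner_Integration.integral_sum c(1,2) del: Bochner_Integration.integral_diff)
  show "integrable P (\<lambda>s. (norm (Z s))\<^sup>2)"
  proof (rule Bochner_Integration.integrable_bound)
    show "integrable P (\<lambda>s. rmean M (\<lambda>m. (norm (C k m s (v m) - v m))\<^sup>2))"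
      by (intro integrable_mult_right Bochner_Integration.integrable_sum c(3))
    show "(\<lambda>s. (norm (Z s))\<^sup>2) \<in> borel_measurable P"
      using int by measurable
    show "AE s in P. norm ((norm (Z s))\<^sup>2) \<le> norm (rmean M (\<lambda>m. (norm (C k m s (v m) - v m))\<^sup>2))"
    proof (rule AE_I2)
      fix s
      show "norm ((norm (Z s))\<^sup>2) \<le> norm (rmean M (\<lambda>m. (norm (C k m s (v m) - v m))\<^sup>2))"
        unfolding Z_def real_norm_def abs_of_nonneg[OF zero_le_power2]
        by (rule order_trans[OF power2_norm_mean_le abs_ge_self])
    qed
  qed
qed

text \<open>The majorant \<open>f\<close> is the squared norm of a fixed vector plus centered noise,
  so its expectation splits exactly into an exact gradient step and a variance.\<close>

lemma prox_step_estimate: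
  fixes x :: 'a and h :: "nat \<Rightarrow> 'a"
  defines "u \<equiv> \<lambda>m. gradF m x - gradF m xs"
  defines "U \<equiv> (norm (vmean M u))\<^sup>2" and "G \<equiv> rmean M (\<lambda>m. (norm (u m))\<^sup>2)"
    and "H \<equiv> rmean M (\<lambda>m. (norm (h m - gradF m xs))\<^sup>2)"
  obtains f where "integrable P f"
    and "\<And>s. (norm (prox \<gamma> R (x - \<gamma> *\<^sub>R (vmean M h + vmean M (\<lambda>m. C k m s (gradF m x - h m)))) - xs))\<^sup>2 \<le> f s"
    and "expectation f \<le> (norm (x - xs))\<^sup>2 - 2 * \<gamma> * (vmean M u \<bullet> (x - xs)) + \<gamma>\<^sup>2 * U
        + \<gamma>\<^sup>2 * ((1 + b) * (\<omega>av * G - \<zeta> * U) + (1 + 1 / b) * (\<omega>av * H))"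
proof -
  define v where "v = (\<lambda>m. h m - gradF m xs)"
  define Z where "Z = (\<lambda>s. vmean M (\<lambda>m. C k m s (gradF m x - h m) - (gradF m x - h m)))"
  define w where "w = x - xs - \<gamma> *\<^sub>R vmean M u"
  define f where "f = (\<lambda>s. (norm (w + (- \<gamma>) *\<^sub>R Z s))\<^sup>2)"
  have Z: "integrable P Z" "expectation Z = 0" "integrable P (\<lambda>s. (norm (Z s))\<^sup>2)"
    unfolding Z_def by (rule compression_error_mean)+
  have "(norm (prox \<gamma> R (x - \<gamma> *\<^sub>R (vmean M h + vmean M (\<lambda>m. C k m s (gradF m x - h m)))) - xs))\<^sup>2 \<le> f s" for s
  proof -
    have *: "x - \<gamma> *\<^sub>R (vmean M h + vmean M (\<lambda>m. C k m s (gradF m x - h m)))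
        - (xs - \<gamma> *\<^sub>R vmean M (\<lambda>m. gradF m xs)) = w + (- \<gamma>) *\<^sub>R Z s"
      unfolding w_def Z_def u_def vmean_diff by (simp add: algebra_simps)
    show ?thesis
      unfolding f_def *[symmetric] by (intro power_mono prox_dist_optimum norm_ge_zero)
  qed
  moreover have "integrable P f"
    unfolding f_def by (rule second_moment_shift(1)[OF Z])
  moreover have "expectation f \<le> (norm (x - xs))\<^sup>2 - 2 * \<gamma> * (vmean M u \<bullet> (x - xs)) + \<gamma>\<^sup>2 * U
        + \<gamma>\<^sup>2 * ((1 + b) * (\<omega>av * G - \<zeta> * U) + (1 + 1 / b) * (\<omega>av * H))"
  proof -
    have uv: "gradF m x - h m = u m - v m" for m by (simp add: u_def v_def)
    have "expectation (\<lambda>s. (norm (Z s))\<^sup>2) \<le> \<omega>av * rmean M (\<lambda>m. (norm (u m - v m))\<^sup>2)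
        - \<zeta> * (norm (vmean M (\<lambda>m. u m - v m)))\<^sup>2"
      using C_av[of k "\<lambda>m. u m - v m"] unfolding Z_def uv by simp
    also have "\<dots> \<le> (1 + b) * (\<omega>av * G - \<zeta> * U)
        + (1 + 1 / b) * (\<omega>av * H - \<zeta> * (norm (vmean M v))\<^sup>2)"
      using young_variance_form[of b \<zeta> \<omega>av M u v] b omegas
      unfolding U_def G_def H_def v_def[symmetric] by (simp add: v_def)
    \<comment> \<open>The negative term of the memory part is dropped; that of the gradient part is
      kept, since it offsets \<open>U\<close>.\<close>
    also have "\<dots> \<le> (1 + b) * (\<omega>av * G - \<zeta> * U) + (1 + 1 / b) * (\<omega>av * H)"
      using omegas b by (intro add_left_mono mult_left_mono) auto
    finally have "\<gamma>\<^sup>2 * expectation (\<lambda>s. (norm (Z s))\<^sup>2)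
        \<le> \<gamma>\<^sup>2 * ((1 + b) * (\<omega>av * G - \<zeta> * U) + (1 + 1 / b) * (\<omega>av * H))"
      by (rule mult_left_mono) simp
    moreover have "(norm w)\<^sup>2 = (norm (x - xs))\<^sup>2 - 2 * \<gamma> * (vmean M u \<bullet> (x - xs)) + \<gamma>\<^sup>2 * U"
    proof -
      have "(norm (z - \<gamma> *\<^sub>R y))\<^sup>2 = (norm z)\<^sup>2 - 2 * \<gamma> * (y \<bullet> z) + \<gamma>\<^sup>2 * (norm y)\<^sup>2" for z y :: 'a
        unfolding power2_norm_eq_inner
        by (simp add: inner_diff_left inner_diff_right inner_commute power2_eq_square algebra_simps)
      then show ?thesis unfolding w_def U_def .
    qed
    ultimately show ?thesis
      unfolding f_def second_moment_shift(2)[OF Z] by simp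
  qed
  ultimately show ?thesis using that by blast
qed

text \<open>The integrand is what remains after \<open>Q k\<close> has been averaged out, and
  \<open>x\<close> and \<open>h\<close> are frozen; this is the inner integral of the descent
  argument.\<close>

lemma one_step_estimate:
  fixes x :: 'a and h :: "nat \<Rightarrow> 'a"
  shows "(\<integral>\<^sup>+ s. ennreal ((1 - rho) * (norm (x - xs))\<^sup>2
       + rho * (norm (prox \<gamma> R (x - \<gamma> *\<^sub>R (vmean M h + vmean M (\<lambda>m. C k m s (gradF m x - h m)))) - xs))\<^sup>2
       + coef * rmean M (\<lambda>m. (norm (h m + lam *\<^sub>R C k m s (gradF m x - h m) - gradF m xs))\<^sup>2)) \<partial>P)
    \<le> ennreal (rate * ((norm (x - xs))\<^sup>2 + coef * rmean M (\<lambda>m. (norm (h m - gradF m xs))\<^sup>2)))"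
    (is "(\<integral>\<^sup>+ s. ennreal (?D + rho * ?X s + coef * ?Y s) \<partial>P) \<le> ennreal ?r")
proof -
  define u where "u = (\<lambda>m. gradF m x - gradF m xs)"
  define G where "G = rmean M (\<lambda>m. (norm (u m))\<^sup>2)"
  define H where "H = rmean M (\<lambda>m. (norm (h m - gradF m xs))\<^sup>2)"
  define U where "U = (norm (vmean M u))\<^sup>2"
  obtain f where f: "integrable P f" "\<And>s. ?X s \<le> f s"
    and f_le: "expectation f \<le> (norm (x - xs))\<^sup>2 - 2 * \<gamma> * (vmean M u \<bullet> (x - xs)) + \<gamma>\<^sup>2 * U
        + \<gamma>\<^sup>2 * ((1 + b) * (\<omega>av * G - \<zeta> * U) + (1 + 1 / b) * (\<omega>av * H))"
    using prox_step_estimate[of x h k] unfolding u_def G_def H_def U_def by blast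
  have eq: "h m + lam *\<^sub>R C k m s w - gradF m xs = (h m - gradF m xs) + lam *\<^sub>R C k m s w" for m s w
    by simp
  have Y: "integrable P (\<lambda>s. (norm (h m + lam *\<^sub>R C k m s (gradF m x - h m) - gradF m xs))\<^sup>2)"
    "expectation (\<lambda>s. (norm (h m + lam *\<^sub>R C k m s (gradF m x - h m) - gradF m xs))\<^sup>2)
      \<le> (1 - lam) * (norm (h m - gradF m xs))\<^sup>2 + lam * (norm (u m))\<^sup>2" if "m \<in> {1..M}" for m
    using unbiased_op_relaxed_step[OF C[OF that, of k] omegas(1) lam_def,
        of "h m - gradF m xs" "gradF m x - h m"]
    unfolding eq by (simp_all add: u_def)
  have intY: "integrable P ?Y"
    by (intro integrable_mult_right Bochner_Integration.integrable_sum Y(1))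
  have EY: "expectation ?Y \<le> (1 - lam) * H + lam * G"
  proof -
    have "expectation ?Y = rmean M (\<lambda>m. expectation (\<lambda>s. (norm (h m + lam *\<^sub>R C k m s (gradF m x - h m) - gradF m xs))\<^sup>2))"
      using Y(1) by (simp add: Bochner_Integration.integral_sum)
    also have "\<dots> \<le> rmean M (\<lambda>m. (1 - lam) * (norm (h m - gradF m xs))\<^sup>2 + lam * (norm (u m))\<^sup>2)"
      by (intro rmean_mono Y(2))
    also have "\<dots> = (1 - lam) * H + lam * G"
      unfolding sum.distrib sum_distrib_left[symmetric] H_def G_def by (simp add: distrib_left)
    finally show ?thesis .
  qed
  have lin: "integrable P (\<lambda>s. d + r * f s + r' * g s)"
    "expectation (\<lambda>s. d + r * f s + r' * g s) = d + r * expectation f + r' * expectation g"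
    if "integrable P g" for d r r' :: real and g
    using that f(1) by (simp_all add: prob_space)
  have nn: "0 \<le> ?D + rho * f s + coef * ?Y s" for s
    using rho_pos rho_le_1 coef_nonneg order_trans[OF zero_le_power2 f(2)[of s]]
    by (intro add_nonneg_nonneg mult_nonneg_nonneg sum_nonneg) auto
  have "(\<integral>\<^sup>+ s. ennreal (?D + rho * ?X s + coef * ?Y s) \<partial>P)
      \<le> (\<integral>\<^sup>+ s. ennreal (?D + rho * f s + coef * ?Y s) \<partial>P)"
    using f(2) rho_pos
    by (intro nn_integral_mono ennreal_leI add_right_mono add_left_mono mult_left_mono) auto
  also have "\<dots> = ennreal (expectation (\<lambda>s. ?D + rho * f s + coef * ?Y s))"
    using lin(1)[OF intY] nn by (intro nn_integral_eq_integral) auto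
  also have "expectation (\<lambda>s. ?D + rho * f s + coef * ?Y s) = ?D + rho * expectation f + coef * expectation ?Y"
    by (rule lin(2)[OF intY])
  also have "ennreal (?D + rho * expectation f + coef * expectation ?Y) \<le> ennreal ?r"
  proof (rule ennreal_leI)
    show "?D + rho * expectation f + coef * expectation ?Y \<le> ?r"
      unfolding rate_def H_def[symmetric]
    proof (rule diana_step_arith[OF f_le EY, where L = L])
      show "U \<le> G" unfolding U_def G_def by (rule power2_norm_mean_le)
      show "G \<le> L * (vmean M u \<bullet> (x - xs))"
        unfolding G_def u_def by (rule gradient_mean_cocoercive)
      show "\<mu> * (norm (x - xs))\<^sup>2 \<le> vmean M u \<bullet> (x - xs)"
        unfolding u_def by (rule gradient_mean_monotone)
      show "0 \<le> H" unfolding H_def by (intro mult_nonneg_nonneg sum_nonneg) auto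
    qed (use b gamma omegas L mu lam_pos rho_pos in \<open>auto simp: U_def coef_def\<close>)
  qed
  finally show ?thesis .
qed

subsection \<open>Expected descent along the iterates\<close>

text \<open>The algorithm carries the averaged memory as a separate variable. It stays the mean of
  the individual memories because both are updated with the same \<open>lam\<close>, which removes
  it from the analysis.\<close>

lemma unroll_diana:
  fixes x0 :: 'a and h0 :: "nat \<Rightarrow> 'a"
  obtains X X' :: "nat \<Rightarrow> 'w \<Rightarrow> 'a" and Hm :: "nat \<Rightarrow> 'w \<Rightarrow> nat \<Rightarrow> 'a"
  where "\<And>k s. diana M gradF R \<gamma> lam rho x0 h0 (\<lambda>k m. C k m s) (\<lambda>k. Q k s) k
      = (X k s, Hm k s, vmean M (Hm k s))"
    and "\<And>s. X 0 s = x0" "\<And>s. Hm 0 s = h0"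
    and "\<And>k s. X' k s = prox \<gamma> R (X k s - \<gamma> *\<^sub>R (vmean M (Hm k s)
        + vmean M (\<lambda>m. C k m s (gradF m (X k s) - Hm k s m))))"
    and "\<And>k s. X (Suc k) s = X k s + rho *\<^sub>R Q k s (X' k s - X k s)"
    and "\<And>k s m. Hm (Suc k) s m = Hm k s m + lam *\<^sub>R C k m s (gradF m (X k s) - Hm k s m)"
proof -
  define S where "S = (\<lambda>k s. diana M gradF R \<gamma> lam rho x0 h0 (\<lambda>k m. C k m s) (\<lambda>k. Q k s) k)"
  define X where "X = (\<lambda>k s. fst (S k s))"
  define Hm where "Hm = (\<lambda>k s. fst (snd (S k s)))"
  define X' where "X' = (\<lambda>k s. prox \<gamma> R (X k s - \<gamma> *\<^sub>R (vmean M (Hm k s)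
        + vmean M (\<lambda>m. C k m s (gradF m (X k s) - Hm k s m)))))"
  have step: "S (Suc k) s = (X k s + rho *\<^sub>R Q k s (X' k s - X k s),
      (\<lambda>m. Hm k s m + lam *\<^sub>R C k m s (gradF m (X k s) - Hm k s m)),
      vmean M (Hm k s) + lam *\<^sub>R vmean M (\<lambda>m. C k m s (gradF m (X k s) - Hm k s m)))"
    if "S k s = (X k s, Hm k s, vmean M (Hm k s))" for k s
    using that by (simp add: S_def X'_def Let_def)
  have S: "S k s = (X k s, Hm k s, vmean M (Hm k s))" for k s
  proof (induction k)
    case 0
    show ?case by (simp add: S_def X_def Hm_def)
  next
    case (Suc k)
    have "Hm (Suc k) s = (\<lambda>m. Hm k s m + lam *\<^sub>R C k m s (gradF m (X k s) - Hm k s m))"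
      by (subst Hm_def) (simp only: step[OF Suc] fst_conv snd_conv)
    moreover have "snd (snd (S (Suc k) s))
        = vmean M (Hm k s) + lam *\<^sub>R vmean M (\<lambda>m. C k m s (gradF m (X k s) - Hm k s m))"
      by (simp only: step[OF Suc] snd_conv)
    ultimately have "snd (snd (S (Suc k) s)) = vmean M (Hm (Suc k) s)"
      by (simp add: sum.distrib scaleR_add_right scaleR_sum_right[symmetric] mult.commute)
    then show ?case by (simp add: X_def Hm_def prod_eq_iff)
  qed
  note Suc = step[OF S]
  show ?thesis
  proof (rule that[of X Hm X'])
    show "X (Suc k) s = X k s + rho *\<^sub>R Q k s (X' k s - X k s)" for k s
      by (subst X_def) (simp only: Suc fst_conv)
    show "Hm (Suc k) s m = Hm k s m + lam *\<^sub>R C k m s (gradF m (X k s) - Hm k s m)" for k s m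
      by (subst Hm_def) (simp only: Suc fst_conv snd_conv)
    show "X 0 s = x0" "Hm 0 s = h0" for s
      by (simp_all add: X_def Hm_def S_def)
  qed (fact S[unfolded S_def] X'_def[THEN fun_cong, THEN fun_cong])+
qed

lemma lyapunov_eq:
  "lyapunov M gradF xs b \<gamma> \<omega>av \<omega>C \<omega>R (x, h, hbar)
    = (norm (x - xs))\<^sup>2 + coef * rmean M (\<lambda>m. (norm (h m - gradF m xs))\<^sup>2)"
  by (simp add: lyapunov_def coef_def rho_def lam_def)

lemma gradF_measurable [measurable]: "m \<in> {1..M} \<Longrightarrow> gradF m \<in> borel_measurable borel"
  by (rule borel_measurable_continuous_onI[OF lipschitz_on_continuous_on[OF F_smooth]])

text \<open>A selection by choice is not measurable in general; here nonexpansiveness makes it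
  continuous.\<close>

lemma prox_measurable [measurable]: "prox \<gamma> R \<in> borel_measurable borel"
proof (intro borel_measurable_continuous_onI lipschitz_on_continuous_on)
  show "1-lipschitz_on UNIV (prox \<gamma> R)"
    using prox_nonexpansive by (auto intro!: lipschitz_onI simp: dist_norm)
qed

lemma diana_expected_descent:
  fixes x0 :: 'a and h0 :: "nat \<Rightarrow> 'a"
  defines "\<Psi> \<equiv> \<lambda>k s. lyapunov M gradF xs b \<gamma> \<omega>av \<omega>C \<omega>R
      (diana M gradF R \<gamma> lam rho x0 h0 (\<lambda>k m. C k m s) (\<lambda>k. Q k s) k)"
  shows "\<Psi> k \<in> borel_measurable P"
    and "(\<integral>\<^sup>+ s. ennreal (\<Psi> (Suc k) s) \<partial>P) \<le> ennreal rate * (\<integral>\<^sup>+ s. ennreal (\<Psi> k s) \<partial>P)"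
proof -
  obtain A B where sub': "\<forall>k. subalgebra P (A k) \<and> subalgebra P (B k)"
    and ind: "indep_sets (case_sum (\<lambda>k. sets (A k)) (\<lambda>k. sets (B k))) UNIV"
    and mC': "\<forall>k. \<forall>m\<in>{1..M}. (\<lambda>(s, v). C k m s v) \<in> borel_measurable (A k \<Otimes>\<^sub>M borel)"
    and mQ': "\<forall>k. (\<lambda>(s, v). Q k s v) \<in> borel_measurable (B k \<Otimes>\<^sub>M borel)"
    using indep unfolding indep_random_maps_def by (elim exE conjE) (rule that)
  note sub = sub'[THEN spec, THEN conjunct1] sub'[THEN spec, THEN conjunct2]
    and mC = mC'[rule_format] and mQ = mQ'[rule_format]
  obtain X X' :: "nat \<Rightarrow> 'w \<Rightarrow> 'a" and Hm :: "nat \<Rightarrow> 'w \<Rightarrow> nat \<Rightarrow> 'a"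
    where diana: "\<And>k s. diana M gradF R \<gamma> lam rho x0 h0 (\<lambda>k m. C k m s) (\<lambda>k. Q k s) k
      = (X k s, Hm k s, vmean M (Hm k s))"
    and init: "\<And>s. X 0 s = x0" "\<And>s. Hm 0 s = h0"
    and X': "\<And>k s. X' k s = prox \<gamma> R (X k s - \<gamma> *\<^sub>R (vmean M (Hm k s)
        + vmean M (\<lambda>m. C k m s (gradF m (X k s) - Hm k s m))))"
    and X_Suc: "\<And>k s. X (Suc k) s = X k s + rho *\<^sub>R Q k s (X' k s - X k s)"
    and H_Suc: "\<And>k s m. Hm (Suc k) s m = Hm k s m + lam *\<^sub>R C k m s (gradF m (X k s) - Hm k s m)"
    by (rule unroll_diana[of x0 h0]) (rule that)
  have \<Psi>: "\<Psi> k s = (norm (X k s - xs))\<^sup>2 + coef * rmean M (\<lambda>m. (norm (Hm k s m - gradF m xs))\<^sup>2)" for k s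
    unfolding \<Psi>_def diana lyapunov_eq ..

  define N where "N = case_sum A B"
  \<comment> \<open>Strict bounds: iterate \<open>k\<close> has used only the sources with index
    below \<open>k\<close>, so both sources of index \<open>k\<close> are still fresh.\<close>
  define past where "past = (\<lambda>k. Inl ` {..<k} \<union> Inr ` {..<k} :: (nat + nat) set)"
  define \<F> where "\<F> = join_alg P N"
  have N: "N (Inl k) = A k" "N (Inr k) = B k" for k
    by (simp_all add: N_def)
  have subN: "subalgebra P (N i)" for i
    using sub by (cases i) (simp_all add: N_def)
  have indN: "indep_sets (\<lambda>i. sets (N i)) UNIV"
    using ind by (rule indep_sets_cong[THEN iffD1, rotated -1]) (auto simp: N_def split: sum.split)
  have sub\<F>: "subalgebra P (\<F> I)" for I
    unfolding \<F>_def by (rule subalgebra_join_alg[where N = N, OF subN])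
  have mono\<F>: "f \<in> borel_measurable (\<F> J)" if "f \<in> borel_measurable (\<F> I)" "I \<subseteq> J" for f :: "'w \<Rightarrow> 'a" and I J
    using measurable_join_alg_mono[where N = N, OF subN that(2)] that(1) by (simp add: \<F>_def)
  \<comment> \<open>Joint measurability permits evaluation at a random argument. The map
    \<open>i\<close> is the identity for measurability of the iterates, and a projection on a
    product space for the decoupled integrands.\<close>
  have evalC: "(\<lambda>z. C k m (i z) (v z)) \<in> borel_measurable K"
    if "i \<in> measurable K (A k)" "v \<in> borel_measurable K" "m \<in> {1..M}" for K :: "'z measure" and i v k m
    using measurable_compose[OF measurable_Pair[OF that(1,2)] mC[OF that(3)]] by simp
  have evalQ: "(\<lambda>z. Q k (i z) (v z)) \<in> borel_measurable K"
    if "i \<in> measurable K (B k)" "v \<in> borel_measurable K" for K :: "'z measure" and i v k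
    using measurable_compose[OF measurable_Pair[OF that] mQ] by simp
  have idA: "(\<lambda>s. s) \<in> measurable (\<F> I) (A k)" if "Inl k \<in> I" for I k
    using measurable_ident_join_alg[where N = N, OF subN that] by (simp add: \<F>_def N)
  have idB: "(\<lambda>s. s) \<in> measurable (\<F> I) (B k)" if "Inr k \<in> I" for I k
    using measurable_ident_join_alg[where N = N, OF subN that] by (simp add: \<F>_def N)

  have past_Suc: "past (Suc k) = insert (Inr k) (insert (Inl k) (past k))" for k
    by (auto simp: past_def less_Suc_eq)
  \<comment> \<open>The intermediate stage of an iteration: compressors \<open>k\<close> have acted,
    \<open>Q k\<close> has not. The new memory and the proximal point are already determined
    here.\<close>
  have step: "(\<lambda>s. Hm (Suc k) s m) \<in> borel_measurable (\<F> (insert (Inl k) (past k)))"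
    "X' k \<in> borel_measurable (\<F> (insert (Inl k) (past k)))"
    if X: "X k \<in> borel_measurable (\<F> (past k))"
      and H: "\<And>m. m \<in> {1..M} \<Longrightarrow> (\<lambda>s. Hm k s m) \<in> borel_measurable (\<F> (past k))"
      and m: "m \<in> {1..M}" for k m
  proof -
    note [measurable] = mono\<F>[OF X subset_insertI[of _ "Inl k"]] mono\<F>[OF H subset_insertI[of _ "Inl k"]]
    have [measurable]: "(\<lambda>s. C k m s (gradF m (X k s) - Hm k s m)) \<in> borel_measurable (\<F> (insert (Inl k) (past k)))"
      if "m \<in> {1..M}" for m
      using that by (intro evalC idA) measurable
    show "(\<lambda>s. Hm (Suc k) s m) \<in> borel_measurable (\<F> (insert (Inl k) (past k)))"
      unfolding H_Suc using m by measurable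
    show "X' k \<in> borel_measurable (\<F> (insert (Inl k) (past k)))"
      unfolding X'[abs_def] by measurable
  qed
  have meas: "X k \<in> borel_measurable (\<F> (past k))
      \<and> (\<forall>m\<in>{1..M}. (\<lambda>s. Hm k s m) \<in> borel_measurable (\<F> (past k)))" for k
  proof (induction k)
    case 0
    show ?case by (simp add: init[abs_def])
  next
    case (Suc k)
    then have X: "X k \<in> borel_measurable (\<F> (past k))"
      and H: "\<And>m. m \<in> {1..M} \<Longrightarrow> (\<lambda>s. Hm k s m) \<in> borel_measurable (\<F> (past k))" by auto
    have [measurable]: "X k \<in> borel_measurable (\<F> (past (Suc k)))"
      by (rule mono\<F>[OF X]) (auto simp: past_Suc)
    have [measurable]: "X' k \<in> borel_measurable (\<F> (past (Suc k)))"
      \<comment> \<open>\<open>step\<close> was stated for an index \<open>m\<close> in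
        \<open>{1..M}\<close>; the index 1 exists since \<open>M\<close> is at least 1.\<close>
      by (rule mono\<F>[OF step(2)[OF X H, of 1]]) (use M in \<open>auto simp: past_Suc\<close>)
    have [measurable]: "(\<lambda>s. Q k s (X' k s - X k s)) \<in> borel_measurable (\<F> (past (Suc k)))"
    proof (intro evalQ idB)
      show "Inr k \<in> past (Suc k)" by (simp add: past_Suc)
    qed measurable
    have "X (Suc k) \<in> borel_measurable (\<F> (past (Suc k)))"
      unfolding X_Suc[abs_def] by measurable
    moreover have "(\<lambda>s. Hm (Suc k) s m) \<in> borel_measurable (\<F> (past (Suc k)))" if "m \<in> {1..M}" for m
      by (rule mono\<F>[OF step(1)[OF X H that]]) (auto simp: past_Suc)
    ultimately show ?case by blast
  qed
  note X [measurable] = meas[THEN conjunct1]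
  note H [measurable] = meas[THEN conjunct2, rule_format]

  have "\<Psi> k \<in> borel_measurable (\<F> (past k))" for k
    unfolding \<Psi>[abs_def] by measurable
  then show "\<Psi> k \<in> borel_measurable P"
    using measurable_from_subalg[OF sub\<F>] by blast

  have A0: "0 \<le> coef" by (rule coef_nonneg)
  let ?J = "insert (Inl k) (past k)"
  \<comment> \<open>First decoupling: only \<open>Q k\<close> sees the fresh \<open>s\<close>; the
    proximal point and the new memory are frozen at \<open>s'\<close>, which the relaxed step then
    treats as constants.\<close>
  have "(\<integral>\<^sup>+ s. ennreal (\<Psi> (Suc k) s) \<partial>P)
      = (\<integral>\<^sup>+ s'. (\<integral>\<^sup>+ s. ennreal ((norm (X k s' + rho *\<^sub>R Q k s (X' k s' - X k s') - xs))\<^sup>2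
          + coef * rmean M (\<lambda>m. (norm (Hm (Suc k) s' m - gradF m xs))\<^sup>2)) \<partial>P) \<partial>P)"
    unfolding \<Psi> X_Suc
  proof (rule nn_integral_indep_subalgebras[OF sub(2) sub\<F>])
    show "indep_set (sets (B k)) (sets (\<F> ?J))"
      unfolding \<F>_def N(2)[symmetric] by (rule indep_set_join_alg[where N = N, OF subN indN]) (auto simp: past_def)
    note [measurable] = mono\<F>[OF X subset_insertI[of _ "Inl k"]] step[OF X H]
    have [measurable]: "X' k \<in> borel_measurable (\<F> ?J)"
      using step(2)[OF X H, of 1] M by auto
    have [measurable]: "(\<lambda>z. Q k (fst z) (X' k (snd z) - X k (snd z))) \<in> borel_measurable (B k \<Otimes>\<^sub>M \<F> ?J)"
      by (intro evalQ) measurable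
    show "(\<lambda>(s, s'). ennreal ((norm (X k s' + rho *\<^sub>R Q k s (X' k s' - X k s') - xs))\<^sup>2
          + coef * rmean M (\<lambda>m. (norm (Hm (Suc k) s' m - gradF m xs))\<^sup>2)))
        \<in> borel_measurable (B k \<Otimes>\<^sub>M \<F> ?J)"
      unfolding split_beta by measurable
  qed
  also have "\<dots> \<le> (\<integral>\<^sup>+ s. ennreal ((1 - rho) * (norm (X k s - xs))\<^sup>2 + rho * (norm (X' k s - xs))\<^sup>2
          + coef * rmean M (\<lambda>m. (norm (Hm (Suc k) s m - gradF m xs))\<^sup>2)) \<partial>P)"
  proof (rule nn_integral_mono)
    fix s'
    define c where "c = coef * rmean M (\<lambda>m. (norm (Hm (Suc k) s' m - gradF m xs))\<^sup>2)"
    have c: "0 \<le> c" unfolding c_def using A0 by (intro mult_nonneg_nonneg sum_nonneg) auto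
    let ?f = "\<lambda>s. (norm ((X k s' - xs) + rho *\<^sub>R Q k s (X' k s' - X k s')))\<^sup>2"
    note q = unbiased_op_relaxed_step[OF Q[of k] omegas(2) rho_def,
        where y = "X k s' - xs" and v = "X' k s' - X k s'"]
    have "(\<integral>\<^sup>+ s. ennreal (?f s + c) \<partial>P) = ennreal (expectation (\<lambda>s. ?f s + c))"
      using q(1) c by (intro nn_integral_eq_integral) auto
    also have "expectation (\<lambda>s. ?f s + c) = expectation ?f + c"
      using q(1) by (simp add: prob_space)
    also have "ennreal (expectation ?f + c) \<le> ennreal ((1 - rho) * (norm (X k s' - xs))\<^sup>2
        + rho * (norm (X' k s' - xs))\<^sup>2 + c)"
      using q(2) by (intro ennreal_leI) simp
    finally show "(\<integral>\<^sup>+ s. ennreal ((norm (X k s' + rho *\<^sub>R Q k s (X' k s' - X k s') - xs))\<^sup>2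
          + coef * rmean M (\<lambda>m. (norm (Hm (Suc k) s' m - gradF m xs))\<^sup>2)) \<partial>P)
        \<le> ennreal ((1 - rho) * (norm (X k s' - xs))\<^sup>2 + rho * (norm (X' k s' - xs))\<^sup>2
          + coef * rmean M (\<lambda>m. (norm (Hm (Suc k) s' m - gradF m xs))\<^sup>2))"
      unfolding c_def[symmetric] by (simp only: add_diff_eq add_diff_add diff_add_eq)
  qed
  \<comment> \<open>Second decoupling: the proximal point and the new memory are unfolded so that
    the compressors see a fresh \<open>s\<close>, while the state of iteration \<open>k\<close>
    stays at \<open>s'\<close>.\<close>
  also have "\<dots> = (\<integral>\<^sup>+ s'. (\<integral>\<^sup>+ s. ennreal ((1 - rho) * (norm (X k s' - xs))\<^sup>2
       + rho * (norm (prox \<gamma> R (X k s' - \<gamma> *\<^sub>R (vmean M (Hm k s')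
            + vmean M (\<lambda>m. C k m s (gradF m (X k s') - Hm k s' m)))) - xs))\<^sup>2
       + coef * rmean M (\<lambda>m. (norm (Hm k s' m + lam *\<^sub>R C k m s (gradF m (X k s') - Hm k s' m)
            - gradF m xs))\<^sup>2)) \<partial>P) \<partial>P)"
    unfolding H_Suc X'
  proof (rule nn_integral_indep_subalgebras[OF sub(1) sub\<F>])
    show "indep_set (sets (A k)) (sets (\<F> (past k)))"
      unfolding \<F>_def N(1)[symmetric] by (rule indep_set_join_alg[where N = N, OF subN indN]) (auto simp: past_def)
    have [measurable]: "(\<lambda>z. C k m (fst z) (gradF m (X k (snd z)) - Hm k (snd z) m))
        \<in> borel_measurable (A k \<Otimes>\<^sub>M \<F> (past k))" if "m \<in> {1..M}" for m
      using that by (intro evalC) measurable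
    show "(\<lambda>(s, s'). ennreal ((1 - rho) * (norm (X k s' - xs))\<^sup>2
       + rho * (norm (prox \<gamma> R (X k s' - \<gamma> *\<^sub>R (vmean M (Hm k s')
            + vmean M (\<lambda>m. C k m s (gradF m (X k s') - Hm k s' m)))) - xs))\<^sup>2
       + coef * rmean M (\<lambda>m. (norm (Hm k s' m + lam *\<^sub>R C k m s (gradF m (X k s') - Hm k s' m)
            - gradF m xs))\<^sup>2))) \<in> borel_measurable (A k \<Otimes>\<^sub>M \<F> (past k))"
      unfolding split_beta by measurable
  qed
  also have "\<dots> \<le> (\<integral>\<^sup>+ s. ennreal (rate * \<Psi> k s) \<partial>P)"
    unfolding \<Psi> by (intro nn_integral_mono one_step_estimate)
  also have "\<dots> = ennreal rate * (\<integral>\<^sup>+ s. ennreal (\<Psi> k s) \<partial>P)"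
    using rate_nonneg \<open>\<Psi> k \<in> borel_measurable P\<close>
    by (simp add: ennreal_mult' nn_integral_cmult)
  finally show "(\<integral>\<^sup>+ s. ennreal (\<Psi> (Suc k) s) \<partial>P) \<le> ennreal rate * (\<integral>\<^sup>+ s. ennreal (\<Psi> k s) \<partial>P)" .
qed

subsection \<open>Linear convergence and complexity\<close>

lemma diana_linear_convergence:
  fixes x0 :: 'a and h0 :: "nat \<Rightarrow> 'a"
  defines "\<Psi> \<equiv> \<lambda>k s. lyapunov M gradF xs b \<gamma> \<omega>av \<omega>C \<omega>R
      (diana M gradF R \<gamma> lam rho x0 h0 (\<lambda>k m. C k m s) (\<lambda>k. Q k s) k)"
    and "\<Psi>0 \<equiv> lyapunov M gradF xs b \<gamma> \<omega>av \<omega>C \<omega>R (x0, h0, vmean M h0)"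
  shows "0 \<le> \<Psi>0" "integrable P (\<Psi> k)" "expectation (\<Psi> k) \<le> rate ^ k * \<Psi>0"
proof -
  have lyapunov_nonneg: "0 \<le> lyapunov M gradF xs b \<gamma> \<omega>av \<omega>C \<omega>R z" for z
    using coef_nonneg unfolding lyapunov_eq[of "fst z" "fst (snd z)" "snd (snd z)", simplified prod.collapse]
    by (intro add_nonneg_nonneg mult_nonneg_nonneg sum_nonneg) auto
  then show \<Psi>0: "0 \<le> \<Psi>0" by (simp add: \<Psi>0_def)
  have nn: "0 \<le> \<Psi> k s" for k s by (simp add: \<Psi>_def lyapunov_nonneg)
  have meas: "\<Psi> k \<in> borel_measurable P" for k
    unfolding \<Psi>_def by (rule diana_expected_descent(1))
  have le: "(\<integral>\<^sup>+ s. ennreal (\<Psi> k s) \<partial>P) \<le> ennreal (rate ^ k * \<Psi>0)" for k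
  proof (induction k)
    case 0
    show ?case by (simp add: \<Psi>_def \<Psi>0_def emeasure_space_1)
  next
    case (Suc k)
    have "(\<integral>\<^sup>+ s. ennreal (\<Psi> (Suc k) s) \<partial>P) \<le> ennreal rate * (\<integral>\<^sup>+ s. ennreal (\<Psi> k s) \<partial>P)"
      unfolding \<Psi>_def by (rule diana_expected_descent(2))
    also have "\<dots> \<le> ennreal rate * ennreal (rate ^ k * \<Psi>0)"
      by (rule mult_left_mono[OF Suc]) simp
    also have "\<dots> = ennreal (rate ^ Suc k * \<Psi>0)"
      using rate_nonneg by (simp add: ennreal_mult'[symmetric] mult.assoc)
    finally show ?case .
  qed
  \<comment> \<open>The bound on the extended integral is finite, which supplies integrability and
    permits the passage to the Bochner integral.\<close>
  have fin: "(\<integral>\<^sup>+ s. ennreal (\<Psi> k s) \<partial>P) < \<infinity>"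
    using le[of k] by (rule order_le_less_trans) simp
  show int: "integrable P (\<Psi> k)"
    using meas nn fin by (intro integrableI_nonneg) auto
  have "ennreal (expectation (\<Psi> k)) \<le> ennreal (rate ^ k * \<Psi>0)"
    using le[of k] nn_integral_eq_integral[OF int] nn by simp
  then show "expectation (\<Psi> k) \<le> rate ^ k * \<Psi>0"
    using rate_nonneg \<Psi>0 by (subst (asm) ennreal_le_iff) auto
qed

text \<open>The maximum is at most 1, since \<open>\<zeta>\<close> is nonnegative. Thus
  \<open>\<zeta>\<close> disappears from the complexity, and \<open>(1 + b)\<^sup>2\<close> enters
  its constant.\<close>

lemma step_size_factor_bound:
  "max (1 - (1 + b) * \<zeta>) 0 + (1 + b)\<^sup>2 * \<omega>av \<le> (1 + b)\<^sup>2 * (1 + \<omega>av)"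
proof -
  have "0 \<le> (1 + b) * \<zeta>" using b omegas by simp
  moreover have "1 \<le> (1 + b)\<^sup>2" using b by (intro one_le_power) simp
  ultimately show ?thesis by (auto simp: distrib_left)
qed

text \<open>Up to the constant, the sum in the bound dominates the inverse of the gap
  \<open>1 - rate\<close>: each part of \<open>complexity_const\<close> handles one entry of the
  minimum. The inequality between \<open>1 - t\<close> and \<open>exp (- t)\<close> then converts
  the gap into an iteration count.\<close>

lemma rate_complexity:
  fixes k :: nat
  assumes \<theta>: "0 < \<theta>" and \<epsilon>: "0 < \<epsilon>" "\<epsilon> \<le> 1"
    and large: "\<theta> \<le> \<gamma> * L * (max (1 - (1 + b) * \<zeta>) 0 + (1 + b)\<^sup>2 * \<omega>av)"
    and k: "real k \<ge> complexity_const b \<theta> * (L / \<mu> * (1 + \<omega>av) * (1 + \<omega>R) + \<omega>C) * ln (1 / \<epsilon>)"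
  shows "rate ^ k \<le> \<epsilon>"
proof -
  define W where "W = L / \<mu> * (1 + \<omega>av) * (1 + \<omega>R)"
  define K where "K = complexity_const b \<theta>"
  have b2: "0 < 1 - 1 / b\<^sup>2"
    using contraction_H_bounds(1) lam_pos by (simp add: zero_less_mult_iff)
  have K: "(1 + b)\<^sup>2 / \<theta> \<le> K" "1 / (1 - 1 / b\<^sup>2) \<le> K"
    by (simp_all add: K_def complexity_const_def)
  have K0: "0 < K" using K(1) \<theta> b by (smt (verit) divide_pos_pos zero_less_power)
  have W1: "1 \<le> W"
  proof -
    have "1 * 1 * 1 \<le> L / \<mu> * (1 + \<omega>av) * (1 + \<omega>R)"
      using mu mu_le_L omegas by (intro mult_mono) auto
    then show ?thesis by (simp add: W_def)
  qed
  have "1 \<le> (\<gamma> * \<mu> * rho) * (K * (W + \<omega>C))"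
  proof -
    have "\<theta> \<le> \<gamma> * L * ((1 + b)\<^sup>2 * (1 + \<omega>av))"
      using gamma(1) L by (intro order_trans[OF large] mult_left_mono step_size_factor_bound) auto
    then have "1 \<le> (1 + b)\<^sup>2 / \<theta> * (\<gamma> * L * (1 + \<omega>av))"
      using \<theta> by (simp add: field_simps)
    also have "\<dots> \<le> K * (\<gamma> * L * (1 + \<omega>av))"
      using K(1) gamma(1) L omegas by (intro mult_right_mono) auto
    also have "\<gamma> * L * (1 + \<omega>av) = (\<gamma> * \<mu> * rho) * W"
      using mu omegas by (simp add: W_def rho_def)
    also have "K * ((\<gamma> * \<mu> * rho) * W) \<le> K * ((\<gamma> * \<mu> * rho) * (W + \<omega>C))"
      using K0 gamma(1) mu rho_pos omegas by (intro mult_left_mono) auto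
    finally show ?thesis by (simp add: mult_ac)
  qed
  moreover have "1 \<le> ((1 - 1 / b\<^sup>2) * lam) * (K * (W + \<omega>C))"
  proof -
    have "lam * (1 + \<omega>C) = 1"
      using omegas by (simp add: lam_def)
    then have "1 = ((1 - 1 / b\<^sup>2) * (1 / (1 - 1 / b\<^sup>2))) * (lam * (1 + \<omega>C))"
      using b2 by (metis less_irrefl mult_1 nonzero_divide_eq_eq mult.commute)
    \<comment> \<open>Here \<open>1 + \<omega>C\<close> is enlarged to \<open>W + \<omega>C\<close>,
      using that \<open>W\<close> is at least 1.\<close>
    also have "\<dots> \<le> ((1 - 1 / b\<^sup>2) * K) * (lam * (W + \<omega>C))"
      using b2 K(2) W1 omegas lam_pos K0 by (intro mult_mono mult_left_mono mult_nonneg_nonneg) auto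
    finally show ?thesis by (simp add: mult_ac)
  qed
  ultimately have gap: "1 \<le> (1 - rate) * (K * (W + \<omega>C))"
    by (simp add: rate_def min_def)
  have ln: "0 \<le> ln (1 / \<epsilon>)" using \<epsilon> by simp
  have "ln (1 / \<epsilon>) \<le> (1 - rate) * (K * (W + \<omega>C)) * ln (1 / \<epsilon>)"
    using mult_right_mono[OF gap ln] by simp
  also have "\<dots> \<le> (1 - rate) * real k"
    using k rate_less_1 unfolding K_def[symmetric] W_def[symmetric]
    by (simp only: mult.assoc) (intro mult_left_mono, auto)
  finally have ln_le: "- ((1 - rate) * real k) \<le> ln \<epsilon>"
    using \<epsilon> by (simp add: ln_div)
  have "rate ^ k \<le> exp (- (1 - rate)) ^ k"
    using exp_ge_add_one_self[of "- (1 - rate)"] rate_nonneg by (intro power_mono) auto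
  also have "\<dots> = exp (- ((1 - rate) * real k))"
    by (simp add: exp_of_nat_mult[symmetric] algebra_simps)
  also have "\<dots> \<le> exp (ln \<epsilon>)" using ln_le by simp
  finally show ?thesis using \<epsilon> by simp
qed

end

theorem theorem5:
  fixes M :: nat
    and F :: "nat \<Rightarrow> 'a::euclidean_space \<Rightarrow> real"
    and gradF :: "nat \<Rightarrow> 'a \<Rightarrow> 'a"
    and R :: "'a \<Rightarrow> ereal"
    and L \<mu> \<omega>C \<omega>R \<omega>av \<zeta> \<gamma> a b c :: real
    and xs x0 :: 'a
    and h0 :: "nat \<Rightarrow> 'a"
    and P :: "'w measure"
    and C :: "nat \<Rightarrow> nat \<Rightarrow> 'w \<Rightarrow> 'a \<Rightarrow> 'a"
    and Q :: "nat \<Rightarrow> 'w \<Rightarrow> 'a \<Rightarrow> 'a"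
    and S :: "nat \<Rightarrow> 'w \<Rightarrow> 'a \<times> (nat \<Rightarrow> 'a) \<times> 'a"
    and \<Psi> :: "'a \<times> (nat \<Rightarrow> 'a) \<times> 'a \<Rightarrow> real"
  assumes M: "M \<ge> 1"
    and L: "L > 0"
    and mu: "\<mu> > 0"
    and F_convex: "\<forall>m\<in>{1..M}. convex_on UNIV (F m)"
    and F_grad: "\<forall>m\<in>{1..M}. \<forall>x. GDERIV (F m) x :> gradF m x"
    and F_smooth: "\<forall>m\<in>{1..M}. L-lipschitz_on UNIV (gradF m)"
    and F_strong: "convex_on UNIV (\<lambda>x. (1 / real M) * (\<Sum>m=1..M. F m x) - \<mu> / 2 * (norm x)\<^sup>2)"
    and R: "proper_closed_convex R"
    and xs: "is_arg_min (\<lambda>x. R x + ereal ((1 / real M) * (\<Sum>m=1..M. F m x))) (\<lambda>_. True) xs"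
    and P: "prob_space P"
    and omegas: "\<omega>C \<ge> 0" "\<omega>R \<ge> 0" "0 \<le> \<omega>av" "\<omega>av \<le> \<omega>C" "0 \<le> \<zeta>" "\<zeta> \<le> \<omega>av"
    and indep: "indep_random_maps P M C Q"
    and C: "\<forall>k. \<forall>m\<in>{1..M}. unbiased_op P \<omega>C (C k m)"
    and Q: "\<forall>k. unbiased_op P \<omega>R (Q k)"
    and C_av: "\<forall>k. \<forall>v :: nat \<Rightarrow> 'a.
        (\<integral>s. (norm ((1 / real M) *\<^sub>R (\<Sum>m=1..M. C k m s (v m) - v m)))\<^sup>2 \<partial>P)
        \<le> \<omega>av / real M * (\<Sum>m=1..M. (norm (v m))\<^sup>2)
          - \<zeta> * (norm ((1 / real M) *\<^sub>R (\<Sum>m=1..M. v m)))\<^sup>2"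
    and b: "b > 1"
    and a: "a = max (1 - (1 + b) * \<zeta>) 0"
    and gamma: "0 < \<gamma>" "\<gamma> \<le> 1 / L * (1 / (a + (1 + b)\<^sup>2 * \<omega>av))"
    and S: "\<forall>k s. S k s = diana M gradF R \<gamma> (1 / (1 + \<omega>C)) (1 / (1 + \<omega>R)) x0 h0
                           (\<lambda>k m. C k m s) (\<lambda>k. Q k s) k"
    and Psi: "\<Psi> = lyapunov M gradF xs b \<gamma> \<omega>av \<omega>C \<omega>R"
    and c: "c = 1 - min (\<gamma> * \<mu> / (1 + \<omega>R)) ((1 - 1 / b\<^sup>2) / (1 + \<omega>C))"
  shows "c < 1 \<and>
    (\<forall>k. integrable P (\<lambda>s. \<Psi> (S k s)) \<and>
         (\<integral>s. \<Psi> (S k s) \<partial>P) \<le> c ^ k * \<Psi> (x0, h0, (1 / real M) *\<^sub>R (\<Sum>m=1..M. h0 m))) \<and>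
    (\<forall>\<theta>. 0 < \<theta> \<and> \<theta> \<le> 1 \<and> \<theta> / L * (1 / (a + (1 + b)\<^sup>2 * \<omega>av)) \<le> \<gamma> \<longrightarrow>
      (\<forall>\<epsilon>. 0 < \<epsilon> \<and> \<epsilon> \<le> 1 / 2 \<longrightarrow>
        (\<forall>k::nat. real k \<ge> complexity_const b \<theta> *
              (L / \<mu> * (1 + \<omega>av) * (1 + \<omega>R) + \<omega>C) * ln (1 / \<epsilon>) \<longrightarrow>
           (\<integral>s. \<Psi> (S k s) \<partial>P) \<le> \<epsilon> * \<Psi> (x0, h0, (1 / real M) *\<^sub>R (\<Sum>m=1..M. h0 m)))))"
proof -
  define s where "s = a + (1 + b)\<^sup>2 * \<omega>av"
  \<comment> \<open>Clearing the denominator requires it to be positive: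
    \<open>\<omega>av = 0\<close> forces \<open>\<zeta> = 0\<close> and hence
    \<open>a = 1\<close>.\<close>
  have s_pos: "0 < s"
  proof (cases "\<omega>av = 0")
    case True
    then show ?thesis using omegas by (simp add: s_def a)
  next
    case False
    then have "0 < (1 + b)\<^sup>2 * \<omega>av" using omegas b by simp
    then show ?thesis by (simp add: s_def a add_nonneg_pos)
  qed
  interpret prob_space P by (rule P)
  interpret D: diana_setup P M F gradF R L \<mu> \<omega>C \<omega>R \<omega>av \<zeta> \<gamma> b xs C Q
  proof
    show "\<gamma> * L * (max (1 - (1 + b) * \<zeta>) 0 + (1 + b)\<^sup>2 * \<omega>av) \<le> 1"
      using gamma(2) L s_pos unfolding a[symmetric] s_def[symmetric] by (simp add: field_simps)
  qed (use M L mu F_convex F_grad F_smooth F_strong R xs omegas indep C Q C_av b gamma in \<open>auto\<close>)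
  have rate: "c = D.rate"
    by (simp add: c D.rate_def D.rho_def D.lam_def)
  have \<Psi>: "\<Psi> (S k s) = lyapunov M gradF xs b \<gamma> \<omega>av \<omega>C \<omega>R
      (diana M gradF R \<gamma> D.lam D.rho x0 h0 (\<lambda>k m. C k m s) (\<lambda>k. Q k s) k)" for k s
    using S by (simp add: Psi D.lam_def D.rho_def)
  let ?\<Psi>0 = "\<Psi> (x0, h0, (1 / real M) *\<^sub>R (\<Sum>m=1..M. h0 m))"
  note conv = D.diana_linear_convergence[where ?x0.0 = x0 and ?h0.0 = h0, folded \<Psi> rate Psi]
  have "(\<integral>s. \<Psi> (S k s) \<partial>P) \<le> \<epsilon> * ?\<Psi>0"
    if "0 < \<theta>" "\<theta> / L * (1 / (a + (1 + b)\<^sup>2 * \<omega>av)) \<le> \<gamma>" "0 < \<epsilon>" "\<epsilon> \<le> 1 / 2"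
      "real k \<ge> complexity_const b \<theta> * (L / \<mu> * (1 + \<omega>av) * (1 + \<omega>R) + \<omega>C) * ln (1 / \<epsilon>)"
    for \<theta> \<epsilon> :: real and k :: nat
  proof -
    have "\<theta> \<le> \<gamma> * L * (max (1 - (1 + b) * \<zeta>) 0 + (1 + b)\<^sup>2 * \<omega>av)"
      using that(2) L s_pos unfolding a[symmetric] s_def[symmetric] by (simp add: field_simps)
    then have "c ^ k \<le> \<epsilon>"
      unfolding rate using that by (intro D.rate_complexity) auto
    with conv(3)[of k] show ?thesis
      using mult_right_mono[OF _ conv(1)] order_trans by blast
  qed
  then show ?thesis
    using conv(2,3) D.rate_less_1 rate by blast
qed

end
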